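(* Let $H$ be a finite group, let $r\in\mathbb N$, $r\ge 1$, let $\mathbb F_r$ be the free group of rank $r$ and let $\mathcal G$ be any Cayley graph of the wreath product $\Gamma=H\wr\mathbb F_r$ (with respect to a finite symmetric generating set). Then there exists a constant $C>0$ such that for every $\alpha<1$ there exist a $\Gamma$-invariant bond percolation $\mathbb P$ on $\mathcal G$ and $\beta,\gamma>0$ with $\beta/\gamma\le C$ such that $\mathbb E[\deg_\omega(o)]>\alpha\deg(o)$ and $$e^{-\beta|g|}\le\tau(o,g)\le e^{-\gamma|g|}\qquad\text{for all } g\in\Gamma.$$
   Context: For groups $H,G$, the (restricted) wreath product $H\wr G$ is the semidirect product $H^{(G)}\rtimes G$, where $H^{(G)}$ is the group of functions $\varphi:G\to H$ with $\varphi(y)=e_H$ for all but finitely many $y$, and $G$ acts by left translation, $(x\varphi)(y)=\varphi(x^{-1}y)$. Right Cayley graph of $\Gamma$: vertex set $\Gamma$ and edge set $E=\{[g,gs]: g\in\Gamma, s\in S\}$, where $S$ is a finite symmetric generating set; $o$ is the identity, $|g|$ the graph distance from $o$ to $g$ in $\mathcal G$, $\deg(o)$ the degree of $o$. $\Gamma$ acts on $\mathcal G$ by left multiplication. A bond percolation on $\mathcal G$ is a probability measure $\mathbb P$ on subsets $\omega$ of $E$, with expectation $\mathbb E$; it is $\Gamma$-invariant if invariant under the induced action of $\Gamma$. The configuration $\omega$ is identified with the subgraph $(\Gamma,\omega)$; clusters are its connected components; $\deg_\omega(o)$ is the degree of $o$ in $\omega$; $\tau(g,h)=\mathbb P[g\leftrightarrow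 h]$ is the probability that $g$ and $h$ are in the same cluster. *)

theory Defs
  imports "HOL-Probability.Probability" "HOL-Algebra.Algebra"
begin

section \<open>Free groups\<close>

text \<open>The letter \<open>(i, True)\<close> is the \<open>i\<close>-th free generator and \<open>(i, False)\<close> its inverse.
  The free group of rank \<open>r\<close> consists of the reduced words in the letters with \<open>i < r\<close>; the product
  of \<open>u\<close> and \<open>v\<close> is the reduced form of their concatenation, obtained by pushing the letters of \<open>u\<close>
  onto \<open>v\<close> one at a time, starting with the last one.\<close>

type_synonym letter = "nat \<times> bool"

definition letter_inv :: "letter \<Rightarrow> letter" where
  "letter_inv x = (fst x, \<not> snd x)"

definition reduced_word :: "letter list \<Rightarrow> bool" where
  "reduced_word w \<longleftrightarrow> successively (\<lambda>x y. y \<noteq> letter_inv x) w"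

definition push :: "letter \<Rightarrow> letter list \<Rightarrow> letter list" where
  "push x w = (case w of [] \<Rightarrow> [x] | y # ys \<Rightarrow> if y = letter_inv x then ys else x # w)"

definition free_group :: "nat \<Rightarrow> letter list monoid" where
  "free_group r =
     \<lparr>carrier = {w. reduced_word w \<and> fst ` set w \<subseteq> {..<r}},
      mult = (\<lambda>u v. foldr push u v),
      one = []\<rparr>"

lemma letter_inv_letter_inv [simp]: "letter_inv (letter_inv x) = x"
  by (simp add: letter_inv_def)

lemma reduced_word_Nil [simp]: "reduced_word []"
  by (simp add: reduced_word_def)

lemma reduced_word_Cons: "reduced_word (x # w) \<longleftrightarrow> (w = [] \<or> hd w \<noteq> letter_inv x) \<and> reduced_word w"
  by (auto simp: reduced_word_def successively_Cons)

lemma reduced_word_push: "reduced_word w \<Longrightarrow> reduced_word (push x w)"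
  by (cases w) (auto simp: push_def reduced_word_Cons)

lemma push_letter_inv_push: "reduced_word w \<Longrightarrow> push (letter_inv x) (push x w) = w"
  by (cases w) (auto simp: push_def reduced_word_Cons split: list.splits)

lemma reduced_word_foldr_push: "reduced_word w \<Longrightarrow> reduced_word (foldr push u w)"
  by (induction u) (auto intro: reduced_word_push)

lemma foldr_push_push:
  assumes "reduced_word w"
  shows "foldr push (push x u) w = push x (foldr push u w)"
proof (cases "\<exists>ys. u = letter_inv x # ys")
  case True
  then obtain ys where "u = letter_inv x # ys" by blast
  with push_letter_inv_push[OF reduced_word_foldr_push[OF assms], of "letter_inv x" ys]
  show ?thesis by (simp add: push_def[of x "letter_inv x # ys"])
next
  case False
  then have "push x u = x # u" by (cases u) (auto simp: push_def)
  then show ?thesis by simp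
qed

lemma foldr_push_assoc:
  "reduced_word w \<Longrightarrow> foldr push (foldr push u v) w = foldr push u (foldr push v w)"
  by (induction u) (auto simp: foldr_push_push)

lemma set_push: "set (push x w) \<subseteq> insert x (set w)"
  by (cases w) (auto simp: push_def)

lemma set_foldr_push: "set (foldr push u w) \<subseteq> set u \<union> set w"
  using set_push by (induction u) fastforce+

lemma fst_set_foldr_push:
  assumes "fst ` set u \<subseteq> A" "fst ` set w \<subseteq> A"
  shows "fst ` set (foldr push u w) \<subseteq> A"
  using assms set_foldr_push[of u w] by blast

lemma foldr_push_letter_inv: "foldr push (rev (map letter_inv u)) u = []"
  by (induction u) (auto simp: push_def)

lemma group_free_group: "group (free_group r)"
proof (rule groupI)
  fix u v assume "u \<in> carrier (free_group r)" "v \<in> carrier (free_group r)"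
  then show "u \<otimes>\<^bsub>free_group r\<^esub> v \<in> carrier (free_group r)"
    using fst_set_foldr_push[of u "{..<r}" v]
    by (simp add: free_group_def reduced_word_foldr_push)
next
  fix u assume u: "u \<in> carrier (free_group r)"
  let ?v = "foldr push (rev (map letter_inv u)) []"
  have "fst ` set (rev (map letter_inv u)) = fst ` set u"
    by (force simp: letter_inv_def image_image)
  then have "fst ` set (rev (map letter_inv u)) \<subseteq> {..<r}"
    using u by (simp only: free_group_def) simp
  then have "fst ` set ?v \<subseteq> {..<r}"
    by (rule fst_set_foldr_push) simp
  then have "?v \<in> carrier (free_group r)"
    by (simp add: free_group_def reduced_word_foldr_push)
  moreover have "?v \<otimes>\<^bsub>free_group r\<^esub> u = \<one>\<^bsub>free_group r\<^esub>"
    using u by (simp add: free_group_def foldr_push_assoc foldr_push_letter_inv)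
  ultimately show "\<exists>v\<in>carrier (free_group r). v \<otimes>\<^bsub>free_group r\<^esub> u = \<one>\<^bsub>free_group r\<^esub>"
    by blast
qed (auto simp: free_group_def foldr_push_assoc)


section \<open>Restricted wreath products\<close>

definition semidirect_product ::
  "('a, 'c) monoid_scheme \<Rightarrow> ('b, 'd) monoid_scheme \<Rightarrow> ('b \<Rightarrow> 'a \<Rightarrow> 'a) \<Rightarrow> ('a \<times> 'b) monoid" where
  "semidirect_product N G \<theta> =
     \<lparr>carrier = carrier N \<times> carrier G,
      mult = (\<lambda>(a, x) (b, y). (a \<otimes>\<^bsub>N\<^esub> \<theta> x b, x \<otimes>\<^bsub>G\<^esub> y)),
      one = (\<one>\<^bsub>N\<^esub>, \<one>\<^bsub>G\<^esub>)\<rparr>"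

definition translate :: "('g, 'd) monoid_scheme \<Rightarrow> 'g \<Rightarrow> ('g \<Rightarrow> 'h) \<Rightarrow> 'g \<Rightarrow> 'h" where
  "translate G x \<phi> = (\<lambda>y\<in>carrier G. \<phi> (inv\<^bsub>G\<^esub> x \<otimes>\<^bsub>G\<^esub> y))"

text \<open>\<open>sum_group\<close> is the direct sum: functions on \<open>carrier G\<close> (\<open>undefined\<close> elsewhere) that differ
  from the identity at only finitely many points, with pointwise multiplication.\<close>

definition wreath_product ::
  "('h, 'c) monoid_scheme \<Rightarrow> ('g, 'd) monoid_scheme \<Rightarrow> (('g \<Rightarrow> 'h) \<times> 'g) monoid" where
  "wreath_product H G =
     semidirect_product (sum_group (carrier G) (\<lambda>_. H)) G (translate G)"

lemma translate_closed:
  assumes "group H" "group G" "x \<in> carrier G" "\<phi> \<in> carrier (sum_group (carrier G) (\<lambda>_. H))"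
  shows "translate G x \<phi> \<in> carrier (sum_group (carrier G) (\<lambda>_. H))"
proof -
  interpret H: group H by fact
  interpret G: group G by fact
  let ?A = "{y \<in> carrier G. \<phi> y \<noteq> \<one>\<^bsub>H\<^esub>}"
  have phi: "\<phi> \<in> carrier G \<rightarrow>\<^sub>E carrier H" "finite ?A"
    using assms(4) by (auto simp: carrier_sum_group H.group_axioms)
  have "{y \<in> carrier G. translate G x \<phi> y \<noteq> \<one>\<^bsub>H\<^esub>} \<subseteq> (\<lambda>y. x \<otimes>\<^bsub>G\<^esub> y) ` ?A"
  proof
    fix y assume "y \<in> {y \<in> carrier G. translate G x \<phi> y \<noteq> \<one>\<^bsub>H\<^esub>}"
    then have "inv\<^bsub>G\<^esub> x \<otimes>\<^bsub>G\<^esub> y \<in> ?A" "y = x \<otimes>\<^bsub>G\<^esub> (inv\<^bsub>G\<^esub> x \<otimes>\<^bsub>G\<^esub> y)"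
      using assms(3) by (auto simp: translate_def G.m_assoc[symmetric])
    then show "y \<in> (\<lambda>y. x \<otimes>\<^bsub>G\<^esub> y) ` ?A" by blast
  qed
  with phi have "finite {y \<in> carrier G. translate G x \<phi> y \<noteq> \<one>\<^bsub>H\<^esub>}"
    by (meson finite_imageI finite_subset)
  moreover have "translate G x \<phi> \<in> carrier G \<rightarrow>\<^sub>E carrier H"
    using phi(1) assms(3) by (auto simp: translate_def)
  ultimately show ?thesis by (simp add: carrier_sum_group H.group_axioms)
qed

lemma group_wreath_product:
  assumes "group H" "group G"
  shows "group (wreath_product H G)"
proof -
  interpret H: group H by fact
  interpret G: group G by fact
  let ?N = "sum_group (carrier G) (\<lambda>_. H)"
  interpret N: group ?N by (simp add: H.group_axioms)
  note car = translate_closed[OF assms]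
  have val: "\<phi> y \<in> carrier H" if "\<phi> \<in> carrier ?N" "y \<in> carrier G" for \<phi> y
    using that by (auto simp: carrier_sum_group H.group_axioms)
  have hom: "translate G x (\<phi> \<otimes>\<^bsub>?N\<^esub> \<psi>) = translate G x \<phi> \<otimes>\<^bsub>?N\<^esub> translate G x \<psi>"
    if "x \<in> carrier G" for x \<phi> \<psi>
    using that by (auto simp: translate_def fun_eq_iff)
  have act: "translate G (x \<otimes>\<^bsub>G\<^esub> y) \<phi> = translate G x (translate G y \<phi>)"
    if "x \<in> carrier G" "y \<in> carrier G" for x y \<phi>
    using that by (auto simp: translate_def fun_eq_iff G.inv_mult_group G.m_assoc)
  have act1: "translate G \<one>\<^bsub>G\<^esub> \<phi> = \<phi>" if "\<phi> \<in> carrier ?N" for \<phi>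
    using that by (auto simp: translate_def fun_eq_iff carrier_sum_group H.group_axioms
        PiE_iff extensional_def)
  have one: "translate G x \<one>\<^bsub>?N\<^esub> = \<one>\<^bsub>?N\<^esub>" if "x \<in> carrier G" for x
    using that by (auto simp: translate_def fun_eq_iff)
  show ?thesis
  proof (rule groupI)
    fix p q assume "p \<in> carrier (wreath_product H G)" "q \<in> carrier (wreath_product H G)"
    then show "p \<otimes>\<^bsub>wreath_product H G\<^esub> q \<in> carrier (wreath_product H G)"
      by (auto simp: wreath_product_def semidirect_product_def simp del: mult_sum_group
          intro!: N.m_closed car)
  next
    show "\<one>\<^bsub>wreath_product H G\<^esub> \<in> carrier (wreath_product H G)"
      using N.one_closed
      by (simp add: wreath_product_def semidirect_product_def del: one_sum_group)
  next
    fix p q s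
    assume "p \<in> carrier (wreath_product H G)" "q \<in> carrier (wreath_product H G)"
      "s \<in> carrier (wreath_product H G)"
    then show "p \<otimes>\<^bsub>wreath_product H G\<^esub> q \<otimes>\<^bsub>wreath_product H G\<^esub> s =
        p \<otimes>\<^bsub>wreath_product H G\<^esub> (q \<otimes>\<^bsub>wreath_product H G\<^esub> s)"
      by (auto simp: wreath_product_def semidirect_product_def N.m_assoc G.m_assoc hom act car
          simp del: mult_sum_group)
  next
    fix p assume "p \<in> carrier (wreath_product H G)"
    then show "\<one>\<^bsub>wreath_product H G\<^esub> \<otimes>\<^bsub>wreath_product H G\<^esub> p = p"
      by (auto simp: wreath_product_def semidirect_product_def act1
          simp del: mult_sum_group one_sum_group)
  next
    fix p assume "p \<in> carrier (wreath_product H G)"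
    then obtain \<phi> x where p: "p = (\<phi>, x)" "\<phi> \<in> carrier ?N" "x \<in> carrier G"
      by (auto simp: wreath_product_def semidirect_product_def)
    let ?q = "(translate G (inv\<^bsub>G\<^esub> x) (inv\<^bsub>?N\<^esub> \<phi>), inv\<^bsub>G\<^esub> x)"
    have "?q \<in> carrier (wreath_product H G)"
      using p by (simp add: wreath_product_def semidirect_product_def car del: inv_sum_group)
    moreover have "?q \<otimes>\<^bsub>wreath_product H G\<^esub> p = \<one>\<^bsub>wreath_product H G\<^esub>"
      using p by (simp add: wreath_product_def semidirect_product_def hom[symmetric] N.l_inv one
          del: mult_sum_group one_sum_group inv_sum_group)
    ultimately show "\<exists>q\<in>carrier (wreath_product H G).
        q \<otimes>\<^bsub>wreath_product H G\<^esub> p = \<one>\<^bsub>wreath_product H G\<^esub>"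
      by blast
  qed
qed


section \<open>Graphs given by their edge sets\<close>

text \<open>An undirected edge with endpoints \<open>x\<close> and \<open>y\<close> is the set \<open>{x, y}\<close>, a loop at \<open>x\<close> the
  singleton \<open>{x}\<close>, which contributes 1 to the degree of \<open>x\<close>.\<close>

definition adj :: "'v set set \<Rightarrow> ('v \<times> 'v) set" where
  "adj E = {(x, y). {x, y} \<in> E}"

definition same_cluster :: "'v set set \<Rightarrow> 'v \<Rightarrow> 'v \<Rightarrow> bool" where
  "same_cluster \<omega> x y \<longleftrightarrow> (x, y) \<in> (adj \<omega>)\<^sup>*"

definition graph_dist :: "'v set set \<Rightarrow> 'v \<Rightarrow> 'v \<Rightarrow> nat" where
  "graph_dist E x y = (LEAST n. (x, y) \<in> adj E ^^ n)"

definition vertex_degree :: "'v set set \<Rightarrow> 'v \<Rightarrow> nat" where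
  "vertex_degree \<omega> x = card {e \<in> \<omega>. x \<in> e}"


section \<open>Cayley graphs\<close>

definition symmetric_generating_set :: "('v, 'c) monoid_scheme \<Rightarrow> 'v set \<Rightarrow> bool" where
  "symmetric_generating_set \<Gamma> S \<longleftrightarrow>
     S \<subseteq> carrier \<Gamma> \<and> (\<forall>s\<in>S. inv\<^bsub>\<Gamma>\<^esub> s \<in> S) \<and> generate \<Gamma> S = carrier \<Gamma>"

definition cayley_edges :: "('v, 'c) monoid_scheme \<Rightarrow> 'v set \<Rightarrow> 'v set set" where
  "cayley_edges \<Gamma> S = {{g, g \<otimes>\<^bsub>\<Gamma>\<^esub> s} |g s. g \<in> carrier \<Gamma> \<and> s \<in> S}"


section \<open>Bond percolation\<close>

text \<open>The configuration space is the set of all subsets of \<open>E\<close> with the product \<open>\<sigma>\<close>-algebra of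
  \<open>{0, 1}\<close> to the power \<open>E\<close>, i.e. the one generated by the events that a given edge is open.\<close>

definition config_space :: "'v set set \<Rightarrow> 'v set set measure" where
  "config_space E = sigma (Pow E) {{\<omega> \<in> Pow E. e \<in> \<omega>} |e. e \<in> E}"

definition bond_percolation :: "'v set set \<Rightarrow> 'v set set measure \<Rightarrow> bool" where
  "bond_percolation E P \<longleftrightarrow> prob_space P \<and> sets P = sets (config_space E)"

definition shift_config :: "('v, 'c) monoid_scheme \<Rightarrow> 'v \<Rightarrow> 'v set set \<Rightarrow> 'v set set" where
  "shift_config \<Gamma> g \<omega> = (\<lambda>e. (\<lambda>x. g \<otimes>\<^bsub>\<Gamma>\<^esub> x) ` e) ` \<omega>"

definition invariant_percolation ::
  "('v, 'c) monoid_scheme \<Rightarrow> 'v set set measure \<Rightarrow> bool" where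
  "invariant_percolation \<Gamma> P \<longleftrightarrow> (\<forall>g\<in>carrier \<Gamma>. distr P P (shift_config \<Gamma> g) = P)"

definition two_point :: "'v set set measure \<Rightarrow> 'v \<Rightarrow> 'v \<Rightarrow> real" where
  "two_point P x y = measure P {\<omega> \<in> space P. same_cluster \<omega> x y}"

lemma space_config_space [simp]: "space (config_space E) = Pow E"
  unfolding config_space_def by (rule space_measure_of) auto

lemma sets_config_space:
  "sets (config_space E) = sigma_sets (Pow E) {{\<omega> \<in> Pow E. e \<in> \<omega>} |e. e \<in> E}"
  unfolding config_space_def by (rule sets_measure_of) auto

lemma space_bond_percolation: "bond_percolation E P \<Longrightarrow> space P = Pow E"
  using sets_eq_imp_space_eq[of P "config_space E"] by (simp add: bond_percolation_def)

lemma edge_open_measurable: "{\<omega> \<in> Pow E. e \<in> \<omega>} \<in> sets (config_space E)"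
proof (cases "e \<in> E")
  case True
  then show ?thesis unfolding sets_config_space by (intro sigma_sets.Basic) auto
next
  case False
  then have "{\<omega> \<in> Pow E. e \<in> \<omega>} = {}" by auto
  then show ?thesis by (simp only: sets.empty_sets)
qed

text \<open>The event that \<open>x\<close> and \<open>y\<close> lie in the same cluster is measurable, and so are the maps
  \<open>shift_config \<Gamma> g\<close>, so that neither \<open>measure\<close> nor \<open>distr\<close> takes a default value above.\<close>

lemma same_cluster_measurable:
  assumes "countable E" "\<And>e. e \<in> E \<Longrightarrow> countable e"
  shows "{\<omega> \<in> Pow E. same_cluster \<omega> x y} \<in> sets (config_space E)"
proof -
  let ?M = "config_space E"
  have V: "countable (\<Union>E)" using countable_UN[of E "\<lambda>e. e"] assms by simp
  have step: "{\<omega> \<in> Pow E. (x, y) \<in> adj \<omega> ^^ n} \<in> sets ?M" for n y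
  proof (induction n arbitrary: y)
    case 0
    have "{\<omega> \<in> Pow E. (x, y) \<in> adj \<omega> ^^ 0} = (if x = y then space ?M else {})"
      by (auto simp: Pow_def)
    then show ?case by (simp only: sets.top sets.empty_sets split: if_split) simp
  next
    case (Suc n)
    have "{\<omega> \<in> Pow E. (x, y) \<in> adj \<omega> ^^ Suc n} =
        (\<Union>z\<in>\<Union>E. {\<omega> \<in> Pow E. (x, z) \<in> adj \<omega> ^^ n} \<inter> {\<omega> \<in> Pow E. {z, y} \<in> \<omega>})"
      (is "?A = ?B")
    proof
      show "?A \<subseteq> ?B"
      proof
        fix \<omega> assume \<omega>: "\<omega> \<in> ?A"
        then obtain z where z: "(x, z) \<in> adj \<omega> ^^ n" "{z, y} \<in> \<omega>"
          by (auto simp: adj_def)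
        then have "z \<in> \<Union>E" using \<omega> by blast
        with z \<omega> show "\<omega> \<in> ?B" by blast
      qed
      show "?B \<subseteq> ?A"
        by (auto simp: adj_def)
    qed
    also have "\<dots> \<in> sets ?M"
      by (intro sets.countable_UN'' V sets.Int Suc edge_open_measurable)
    finally show ?case .
  qed
  have "{\<omega> \<in> Pow E. same_cluster \<omega> x y} = (\<Union>n. {\<omega> \<in> Pow E. (x, y) \<in> adj \<omega> ^^ n})"
    by (auto simp: same_cluster_def rtrancl_power)
  also have "\<dots> \<in> sets ?M" using step by blast
  finally show ?thesis .
qed

lemma shift_config_measurable:
  assumes "group \<Gamma>" "S \<subseteq> carrier \<Gamma>" "g \<in> carrier \<Gamma>"
  defines "E \<equiv> cayley_edges \<Gamma> S"
  shows "shift_config \<Gamma> g \<in> measurable (config_space E) (config_space E)"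
proof -
  interpret group \<Gamma> by fact
  let ?m = "\<lambda>g e. (\<lambda>x. g \<otimes>\<^bsub>\<Gamma>\<^esub> x) ` e"
  have shift: "?m h e \<in> E" if "e \<in> E" "h \<in> carrier \<Gamma>" for h e
  proof -
    from that(1) obtain k s where ks: "e = {k, k \<otimes>\<^bsub>\<Gamma>\<^esub> s}" "k \<in> carrier \<Gamma>" "s \<in> S"
      by (auto simp: E_def cayley_edges_def)
    then have "?m h e = {h \<otimes>\<^bsub>\<Gamma>\<^esub> k, (h \<otimes>\<^bsub>\<Gamma>\<^esub> k) \<otimes>\<^bsub>\<Gamma>\<^esub> s}"
      using that(2) assms(2) by (auto simp: m_assoc subset_iff)
    then show ?thesis
      using ks that(2) unfolding E_def cayley_edges_def by blast
  qed
  have sub: "e \<subseteq> carrier \<Gamma>" if "e \<in> E" for e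
    using that assms(2) by (auto simp: E_def cayley_edges_def)
  have inv1: "?m (inv\<^bsub>\<Gamma>\<^esub> h) (?m h e) = e" if "e \<in> E" "h \<in> carrier \<Gamma>" for h e
    using sub[OF that(1)] that(2) by (force simp: image_image m_assoc[symmetric])
  have inv2: "?m g (?m (inv\<^bsub>\<Gamma>\<^esub> g) e) = e" if "e \<in> E" for e
    using inv1[OF that, of "inv\<^bsub>\<Gamma>\<^esub> g"] assms(3) by simp
  have maps: "shift_config \<Gamma> g \<in> Pow E \<rightarrow> Pow E"
    using shift[OF _ assms(3)] unfolding shift_config_def by blast
  have mem: "e \<in> shift_config \<Gamma> g \<omega> \<longleftrightarrow> ?m (inv\<^bsub>\<Gamma>\<^esub> g) e \<in> \<omega>"
    if e: "e \<in> E" and \<omega>: "\<omega> \<subseteq> E" for e \<omega>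
  proof
    assume "e \<in> shift_config \<Gamma> g \<omega>"
    then obtain f where f: "f \<in> \<omega>" "e = ?m g f" unfolding shift_config_def by blast
    have "f \<in> E" using f(1) \<omega> by blast
    from inv1[OF this assms(3)] show "?m (inv\<^bsub>\<Gamma>\<^esub> g) e \<in> \<omega>" using f by simp
  next
    assume "?m (inv\<^bsub>\<Gamma>\<^esub> g) e \<in> \<omega>"
    then have "?m g (?m (inv\<^bsub>\<Gamma>\<^esub> g) e) \<in> shift_config \<Gamma> g \<omega>"
      unfolding shift_config_def by (rule imageI)
    then show "e \<in> shift_config \<Gamma> g \<omega>" unfolding inv2[OF e] .
  qed
  have pre: "shift_config \<Gamma> g -` {\<omega> \<in> Pow E. e \<in> \<omega>} \<inter> Pow E = {\<omega> \<in> Pow E. ?m (inv\<^bsub>\<Gamma>\<^esub> g) e \<in> \<omega>}"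
    if e: "e \<in> E" for e
    using mem[OF e] maps by blast
  show ?thesis
  proof (subst (2) config_space_def, rule measurable_measure_of)
    show "{{\<omega> \<in> Pow E. e \<in> \<omega>} |e. e \<in> E} \<subseteq> Pow (Pow E)" by auto
    show "shift_config \<Gamma> g \<in> space (config_space E) \<rightarrow> Pow E" using maps by simp
    fix A assume "A \<in> {{\<omega> \<in> Pow E. e \<in> \<omega>} |e. e \<in> E}"
    then obtain e where e: "e \<in> E" "A = {\<omega> \<in> Pow E. e \<in> \<omega>}" by blast
    show "shift_config \<Gamma> g -` A \<inter> space (config_space E) \<in> sets (config_space E)"
      unfolding space_config_space e(2) pre[OF e(1)] by (rule edge_open_measurable)
  qed
qed

end

theory Submission
  imports Defs "HOL-Library.Sublist"
begin

text \<open>Delete the sites of the Cayley tree of the free group independently with probability \<open>1 - p\<close>, and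
  keep an edge of the wreath product if all sites in a fixed finite window around the positions of the
  lamplighter at its two ends survive. To reach \<open>g = (\<phi>, x) \<noteq> o\<close> the lamplighter has to move through the
  subtree \<open>T\<close> spanned by the origin, \<open>x\<close> and the support of \<open>\<phi>\<close>, so all sites of \<open>T\<close> survive;
  conversely \<open>g\<close> can be reached by a tour of length \<open>O(|T|)\<close> that stays within bounded distance of
  \<open>T\<close>. Hence \<open>\<tau>(o, g)\<close> lies between \<open>p ^ (c |T|)\<close> and \<open>p ^ |T|\<close>. Since \<open>|T|\<close> and \<open>|g|\<close>
  are comparable with constants that do not depend on \<open>p\<close>, both rates are multiples of \<open>- ln p\<close>, and
  \<open>p\<close> may be taken close to 1.\<close>

section \<open>Prefixes of reduced words\<close>

lemma free_group_simps [simp]: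
  "mult (free_group r) = foldr push"
  "one (free_group r) = []"
  by (simp_all add: free_group_def fun_eq_iff)

lemma reduced_word_prefix: "reduced_word w \<Longrightarrow> prefix u w \<Longrightarrow> reduced_word u"
  by (auto simp: reduced_word_def prefix_def successively_append_iff)

lemma carrier_free_group_prefix:
  "w \<in> carrier (free_group r) \<Longrightarrow> prefix u w \<Longrightarrow> u \<in> carrier (free_group r)"
  using reduced_word_prefix[of w u] set_mono_prefix[of u w] unfolding free_group_def by fastforce

lemma push_Cons_reduced: "reduced_word (x # w) \<Longrightarrow> push x w = x # w"
  by (cases w) (auto simp: push_def reduced_word_Cons)

text \<open>Pushing \<open>x\<close> either cancels the first letter of \<open>w\<close> or prepends
  \<open>x\<close>. After a cancellation \<open>p\<close> comes from the longer prefix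
  \<open>letter_inv x # p\<close> of \<open>w\<close>; otherwise only the empty prefix is not of the
  form \<open>push x q\<close>.\<close>

lemma prefix_pushE:
  assumes "prefix p (push x w)"
  obtains "p = []" | q where "prefix q w" "p = push x q"
proof (cases "\<exists>ys. w = letter_inv x # ys")
  case True
  then obtain ys where ys: "w = letter_inv x # ys" by blast
  then have "prefix (letter_inv x # p) w" "p = push x (letter_inv x # p)"
    using assms by (simp_all add: push_def)
  then show thesis using that(2) by blast
next
  case False
  then have eq: "push x w = x # w" by (cases w) (auto simp: push_def)
  show thesis
  proof (cases p)
    case Nil
    then show thesis using that(1) by blast
  next
    case (Cons y q)
    then have q: "y = x" "prefix q w" using assms eq by auto
    then have "push x q = x # q" using False by (cases q) (auto simp: push_def prefix_def)
    then show thesis using that(2) q Cons by simp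
  qed
qed

text \<open>For reduced words this is a fact about the Cayley tree: the geodesic from the origin to
  the product of \<open>u\<close> and \<open>v\<close> is covered by the geodesic to
  \<open>u\<close> and the \<open>u\<close>-translate of the geodesic to \<open>v\<close>.
  Reducedness of \<open>u\<close> ensures that a letter pushed onto a prefix of the rest of
  \<open>u\<close> is prepended, not cancelled.\<close>

lemma prefix_foldr_pushE:
  assumes "reduced_word u" "prefix p (foldr push u v)"
  obtains "prefix p u" | q where "prefix q v" "p = foldr push u q"
  using assms
proof (induction u arbitrary: p thesis)
  case Nil
  then show ?case by auto
next
  case (Cons x u)
  have u: "reduced_word u" using Cons.prems(3) by (simp add: reduced_word_Cons)
  from Cons.prems(4) have "prefix p (push x (foldr push u v))" by simp
  then show ?case
  proof (cases rule: prefix_pushE)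
    case 1
    then show ?thesis using Cons.prems(1) by simp
  next
    case (2 q)
    show ?thesis
    proof (rule Cons.IH[OF _ _ u 2(1)])
      assume "prefix q u"
      then have "prefix (x # q) (x # u)" by simp
      moreover have "push x q = x # q"
        by (rule push_Cons_reduced) (rule reduced_word_prefix[OF Cons.prems(3) \<open>prefix (x # q) (x # u)\<close>])
      ultimately show ?thesis using Cons.prems(1) 2(2) by simp
    next
      fix q' assume "prefix q' v" "q = foldr push u q'"
      then show ?thesis using Cons.prems(2)[of q'] 2(2) by simp
    qed
  qed
qed

lemma inv_free_group_letter:
  assumes "fst a < r"
  shows "inv\<^bsub>free_group r\<^esub> [a] = [letter_inv a]"
proof -
  interpret F: group "free_group r" by (rule group_free_group)
  have "foldr push [letter_inv a] [a] = []" by (simp add: push_def)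
  moreover have "[a] \<in> carrier (free_group r)" "[letter_inv a] \<in> carrier (free_group r)"
    using assms by (simp_all add: free_group_def reduced_word_Cons letter_inv_def)
  ultimately show ?thesis using F.inv_equality[of "[letter_inv a]" "[a]"] by simp
qed

section \<open>Auxiliary facts on paths, powers and prefixes\<close>

lemma relpow_mono_rel: "R \<subseteq> R' \<Longrightarrow> R ^^ n \<subseteq> R' ^^ n" for R R' :: "('x \<times> 'x) set"
  by (induction n) auto

lemma adj_mono: "A \<subseteq> B \<Longrightarrow> adj A \<subseteq> adj B"
  by (auto simp: adj_def)

text \<open>Powers are continuous at 1 from the left. The value \<open>p\<close> stays strictly
  below 1 so that \<open>ln p\<close> is negative and the decay rates are positive.\<close>

lemma power_close_to_one:
  fixes \<alpha> :: real
  assumes "\<alpha> < 1"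
  obtains p where "0 < p" "p < 1" "\<alpha> < p ^ n"
proof -
  have "((\<lambda>p::real. p ^ n) \<longlongrightarrow> 1 ^ n) (at_left 1)" by (intro tendsto_intros)
  then have "\<forall>\<^sub>F p in at_left 1. \<alpha> < p ^ n" using assms by (intro order_tendstoD) auto
  moreover have "\<forall>\<^sub>F p in at_left (1::real). p \<in> {0<..<1}"
    by (rule eventually_at_left_real) simp
  ultimately have "\<forall>\<^sub>F p in at_left (1::real). 0 < p \<and> p < 1 \<and> \<alpha> < p ^ n"
    by eventually_elim auto
  then show thesis using that eventually_happens[of _ "at_left (1::real)"] by (auto simp: trivial_limit_at_left_real)
qed

lemma finite_prefixes: "finite {p. prefix p v}"
  using finite_set[of "prefixes v"] by (simp add: set_prefixes_eq)

section \<open>Subtrees spanned by wreath product elements\<close>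

locale free_lamplighter =
  fixes H :: "('h, 'c) monoid_scheme" and r :: nat
    and S :: "((letter list \<Rightarrow> 'h) \<times> letter list) set"
  assumes group_H: "group H" and finite_H: "finite (carrier H)"
    and finite_S: "finite S"
    and generating: "symmetric_generating_set (wreath_product H (free_group r)) S"
begin

abbreviation "F \<equiv> free_group r"
abbreviation "\<Gamma> \<equiv> wreath_product H F"
abbreviation "E \<equiv> cayley_edges \<Gamma> S"

sublocale H: group H by (rule group_H)
sublocale F: group F by (rule group_free_group)
sublocale G: group \<Gamma> by (rule group_wreath_product) unfold_locales

lemma S_subset: "S \<subseteq> carrier \<Gamma>" and S_inv: "s \<in> S \<Longrightarrow> inv\<^bsub>\<Gamma>\<^esub> s \<in> S"
  and S_generates: "generate \<Gamma> S = carrier \<Gamma>"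
  using generating by (auto simp: symmetric_generating_set_def)

text \<open>The support of \<open>\<phi>\<close>, taken inside \<open>carrier F\<close> because lamp
  configurations are \<open>undefined\<close> outside it.\<close>

definition lamps :: "(letter list \<Rightarrow> 'h) \<Rightarrow> letter list set" where
  "lamps \<phi> = {y \<in> carrier F. \<phi> y \<noteq> \<one>\<^bsub>H\<^esub>}"

lemma carrier_wreath:
  "carrier \<Gamma> = {(\<phi>, x). \<phi> \<in> carrier F \<rightarrow>\<^sub>E carrier H \<and> finite (lamps \<phi>) \<and> x \<in> carrier F}"
  by (auto simp: wreath_product_def semidirect_product_def carrier_sum_group H.group_axioms lamps_def)

lemma mult_wreath:
  "(\<phi>, x) \<otimes>\<^bsub>\<Gamma>\<^esub> (\<psi>, y) =
    (\<lambda>z\<in>carrier F. \<phi> z \<otimes>\<^bsub>H\<^esub> translate F x \<psi> z, x \<otimes>\<^bsub>F\<^esub> y)"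
  by (simp add: wreath_product_def semidirect_product_def)

lemma one_wreath: "\<one>\<^bsub>\<Gamma>\<^esub> = (\<lambda>z\<in>carrier F. \<one>\<^bsub>H\<^esub>, [])"
  by (simp add: wreath_product_def semidirect_product_def)

lemma snd_mult: "snd (g \<otimes>\<^bsub>\<Gamma>\<^esub> h) = snd g \<otimes>\<^bsub>F\<^esub> snd h"
  by (cases g; cases h) (simp add: mult_wreath)

lemma snd_closed: "g \<in> carrier \<Gamma> \<Longrightarrow> snd g \<in> carrier F"
  by (auto simp: carrier_wreath)

lemma Nil_closed: "[] \<in> carrier F"
  using F.one_closed by simp

text \<open>The smallest subtree of the Cayley tree of \<open>F\<close> that contains the origin, the position of the
  lamplighter and all lamps that are not at the identity.\<close>

definition subtree :: "(letter list \<Rightarrow> 'h) \<times> letter list \<Rightarrow> letter list set" where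
  "subtree g = (\<Union>v\<in>insert (snd g) (lamps (fst g)). {p. prefix p v})"

lemma Cons_closedD: "a # w \<in> carrier F \<Longrightarrow> fst a < r" "a # w \<in> carrier F \<Longrightarrow> w \<in> carrier F"
  by (auto simp: free_group_def reduced_word_Cons)

lemma finite_subtree: "g \<in> carrier \<Gamma> \<Longrightarrow> finite (subtree g)"
  by (auto simp: subtree_def carrier_wreath finite_prefixes)

lemma subtree_subset: "g \<in> carrier \<Gamma> \<Longrightarrow> subtree g \<subseteq> carrier F"
proof
  fix p assume g: "g \<in> carrier \<Gamma>" and "p \<in> subtree g"
  then obtain v where "v \<in> insert (snd g) (lamps (fst g))" "prefix p v"
    by (auto simp: subtree_def)
  moreover from this(1) have "v \<in> carrier F"
    using snd_closed[OF g] by (auto simp: lamps_def)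
  ultimately show "p \<in> carrier F" by (blast intro: carrier_free_group_prefix)
qed

lemma Nil_in_subtree: "[] \<in> subtree g"
  by (auto simp: subtree_def)

lemma subtree_one: "subtree \<one>\<^bsub>\<Gamma>\<^esub> = {[]}"
  by (auto simp: subtree_def one_wreath lamps_def)

lemma subtree_prefix_closed: "v \<in> subtree g \<Longrightarrow> prefix p v \<Longrightarrow> p \<in> subtree g"
  by (auto simp: subtree_def intro: prefix_order.trans)

text \<open>Right multiplication by a generator enlarges a subtree only within the window translated
  to the current position. Inserting \<open>[]\<close> puts the origin into the window even if
  \<open>S\<close> is empty.\<close>

definition window :: "letter list set" where
  "window = insert [] (\<Union>s\<in>S. subtree s)"

lemma finite_window: "finite window"
  using finite_S S_subset by (auto simp: window_def intro!: finite_subtree)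

lemma window_subset: "window \<subseteq> carrier F"
  using S_subset subtree_subset Nil_closed by (auto simp: window_def)

lemma Nil_in_window: "[] \<in> window"
  by (simp add: window_def)

text \<open>The lamp of the product at \<open>v\<close> is \<open>\<phi> v\<close> times the lamp of
  \<open>\<psi>\<close> at \<open>v\<close> seen from \<open>x\<close>, so one of the two factors is
  nontrivial wherever the product is.\<close>

lemma lamps_mult_subset:
  assumes "(\<phi>, x) \<in> carrier \<Gamma>" "(\<psi>, y) \<in> carrier \<Gamma>"
  shows "lamps (fst ((\<phi>, x) \<otimes>\<^bsub>\<Gamma>\<^esub> (\<psi>, y))) \<subseteq> lamps \<phi> \<union> (\<lambda>z. x \<otimes>\<^bsub>F\<^esub> z) ` lamps \<psi>"
proof
  fix v assume v: "v \<in> lamps (fst ((\<phi>, x) \<otimes>\<^bsub>\<Gamma>\<^esub> (\<psi>, y)))"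
  then have vF: "v \<in> carrier F" and ne: "\<phi> v \<otimes>\<^bsub>H\<^esub> \<psi> (inv\<^bsub>F\<^esub> x \<otimes>\<^bsub>F\<^esub> v) \<noteq> \<one>\<^bsub>H\<^esub>"
    by (auto simp: lamps_def mult_wreath translate_def)
  have x: "x \<in> carrier F" using assms(1) by (simp add: carrier_wreath)
  show "v \<in> lamps \<phi> \<union> (\<lambda>z. x \<otimes>\<^bsub>F\<^esub> z) ` lamps \<psi>"
  proof (cases "v \<in> lamps \<phi>")
    case False
    then have "\<psi> (inv\<^bsub>F\<^esub> x \<otimes>\<^bsub>F\<^esub> v) \<noteq> \<one>\<^bsub>H\<^esub>" using ne vF by (auto simp: lamps_def)
    moreover have "inv\<^bsub>F\<^esub> x \<otimes>\<^bsub>F\<^esub> v \<in> carrier F" using x vF by (intro F.m_closed F.inv_closed)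
    ultimately have "inv\<^bsub>F\<^esub> x \<otimes>\<^bsub>F\<^esub> v \<in> lamps \<psi>" by (simp add: lamps_def)
    moreover have "v = x \<otimes>\<^bsub>F\<^esub> (inv\<^bsub>F\<^esub> x \<otimes>\<^bsub>F\<^esub> v)"
      using x vF by (simp only: F.m_assoc[symmetric] F.inv_closed F.r_inv F.l_one)
    ultimately show ?thesis by blast
  qed simp
qed

text \<open>A vertex spanning the subtree of the product is a lit lamp of \<open>g\<close> or a
  translate of a vertex spanning \<open>subtree h\<close>. In the second case
  \<open>prefix_foldr_pushE\<close> splits its prefixes, and prefixes of \<open>snd g\<close> belong
  to \<open>subtree g\<close>.\<close>

lemma subtree_mult_subset:
  assumes g: "g \<in> carrier \<Gamma>" and h: "h \<in> carrier \<Gamma>"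
  shows "subtree (g \<otimes>\<^bsub>\<Gamma>\<^esub> h) \<subseteq> subtree g \<union> (\<lambda>z. snd g \<otimes>\<^bsub>F\<^esub> z) ` subtree h"
proof
  fix p assume "p \<in> subtree (g \<otimes>\<^bsub>\<Gamma>\<^esub> h)"
  then obtain v where v: "v = snd (g \<otimes>\<^bsub>\<Gamma>\<^esub> h) \<or> v \<in> lamps (fst (g \<otimes>\<^bsub>\<Gamma>\<^esub> h))" "prefix p v"
    by (auto simp: subtree_def)
  then consider "v \<in> lamps (fst g)"
    | w where "w \<in> insert (snd h) (lamps (fst h))" "v = foldr push (snd g) w"
    using lamps_mult_subset[of "fst g" "snd g" "fst h" "snd h"] g h
    by (auto simp: snd_mult)
  then show "p \<in> subtree g \<union> (\<lambda>z. snd g \<otimes>\<^bsub>F\<^esub> z) ` subtree h"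
  proof cases
    case 1
    then show ?thesis using v by (auto simp: subtree_def)
  next
    case (2 w)
    have "reduced_word (snd g)" using snd_closed[OF g] by (simp add: free_group_def)
    then show ?thesis
      by (rule prefix_foldr_pushE[where p = p and v = w]) (use v 2 in \<open>auto simp: subtree_def\<close>)
  qed
qed

lemma subtree_step_subset:
  assumes "g \<in> carrier \<Gamma>" "s \<in> S"
  shows "subtree (g \<otimes>\<^bsub>\<Gamma>\<^esub> s) \<subseteq> subtree g \<union> (\<lambda>z. snd g \<otimes>\<^bsub>F\<^esub> z) ` window"
  using subtree_mult_subset[of g s] assms S_subset by (auto simp: window_def)

text \<open>Requiring a whole window around both endpoints, rather than the endpoints alone, makes the open
  sites along an open path from the identity to \<open>g\<close> contain \<open>subtree g\<close>.\<close>

definition sites :: "((letter list \<Rightarrow> 'h) \<times> letter list) set \<Rightarrow> letter list set" where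
  "sites e = (\<Union>g\<in>e. (\<lambda>z. snd g \<otimes>\<^bsub>F\<^esub> z) ` window)"

definition open_bonds :: "letter list set \<Rightarrow> ((letter list \<Rightarrow> 'h) \<times> letter list) set set" where
  "open_bonds W = {e \<in> E. sites e \<subseteq> W}"

lemma open_bonds_mono: "W \<subseteq> W' \<Longrightarrow> open_bonds W \<subseteq> open_bonds W'"
  by (auto simp: open_bonds_def)

section \<open>Edges and the sites on which they depend\<close>

lemma edge_cases:
  assumes "{g, h} \<in> E"
  obtains s where "g \<in> carrier \<Gamma>" "s \<in> S" "h = g \<otimes>\<^bsub>\<Gamma>\<^esub> s"
proof -
  from assms obtain k s where ks: "{g, h} = {k, k \<otimes>\<^bsub>\<Gamma>\<^esub> s}" "k \<in> carrier \<Gamma>" "s \<in> S"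
    by (auto simp: cayley_edges_def)
  then consider "g = k" "h = k \<otimes>\<^bsub>\<Gamma>\<^esub> s" | "h = k" "g = k \<otimes>\<^bsub>\<Gamma>\<^esub> s"
    by (auto simp: doubleton_eq_iff)
  then show thesis
  proof cases
    case 1
    then show thesis using that ks by blast
  next
    case 2
    \<comment> \<open>An edge has no orientation; read backwards, it is given by the inverse
      generator.\<close>
    have s: "s \<in> carrier \<Gamma>" using ks S_subset by blast
    then have "h = g \<otimes>\<^bsub>\<Gamma>\<^esub> inv\<^bsub>\<Gamma>\<^esub> s" "g \<in> carrier \<Gamma>" using 2 ks by (simp_all add: G.m_assoc)
    then show thesis using that S_inv ks by blast
  qed
qed

lemma edge_subset: "e \<in> E \<Longrightarrow> e \<subseteq> carrier \<Gamma>"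
  using S_subset by (auto simp: cayley_edges_def)

lemma finite_edge: "e \<in> E \<Longrightarrow> finite e" and card_edge: "e \<in> E \<Longrightarrow> card e \<le> 2"
  by (auto simp: cayley_edges_def card_insert_if)

lemma finite_sites: "e \<in> E \<Longrightarrow> finite (sites e)"
  using finite_edge finite_window by (auto simp: sites_def)

lemma sites_subset:
  assumes "e \<in> E"
  shows "sites e \<subseteq> carrier F"
proof -
  have "snd g \<otimes>\<^bsub>F\<^esub> z \<in> carrier F" if "g \<in> e" "z \<in> window" for g z
    using that edge_subset[OF assms] window_subset by (intro F.m_closed snd_closed) blast+
  then show ?thesis by (auto simp: sites_def)
qed

text \<open>At most two endpoints contribute one translate of the window each. The bound is uniform
  in the edge and becomes the exponent of \<open>p\<close> in the degree estimate.\<close>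

lemma card_sites: 
  assumes "e \<in> E"
  shows "card (sites e) \<le> 2 * card window"
proof -
  have "card (sites e) \<le> (\<Sum>g\<in>e. card ((\<lambda>z. snd g \<otimes>\<^bsub>F\<^esub> z) ` window))"
    unfolding sites_def by (rule card_UN_le) (rule finite_edge[OF assms])
  also have "\<dots> \<le> (\<Sum>g\<in>e. card window)"
    by (intro sum_mono card_image_le finite_window)
  also have "\<dots> \<le> 2 * card window"
    using card_edge[OF assms] by simp
  finally show ?thesis .
qed

text \<open>Each step of a path adds at most one translate of the window. This is the half of the
  comparison that bounds the subtree by the distance.\<close>

lemma card_subtree_le:
  assumes "(\<one>\<^bsub>\<Gamma>\<^esub>, g) \<in> adj E ^^ n"
  shows "card (subtree g) \<le> 1 + n * card window"
  using assms
proof (induction n arbitrary: g)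
  case 0
  then have "g = \<one>\<^bsub>\<Gamma>\<^esub>" by simp
  then show ?case by (simp only: subtree_one) simp
next
  case (Suc n)
  then obtain h where h: "(\<one>\<^bsub>\<Gamma>\<^esub>, h) \<in> adj E ^^ n" "{h, g} \<in> E" by (auto simp: adj_def)
  obtain s where s: "h \<in> carrier \<Gamma>" "s \<in> S" "g = h \<otimes>\<^bsub>\<Gamma>\<^esub> s" using edge_cases[OF h(2)] .
  have "card (subtree g) \<le> card (subtree h \<union> (\<lambda>z. snd h \<otimes>\<^bsub>F\<^esub> z) ` window)"
    using subtree_step_subset[OF s(1,2)] s finite_subtree finite_window by (intro card_mono) auto
  also have "\<dots> \<le> card (subtree h) + card ((\<lambda>z. snd h \<otimes>\<^bsub>F\<^esub> z) ` window)"
    by (rule card_Un_le)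
  also have "\<dots> \<le> (1 + n * card window) + card window"
    by (intro add_mono Suc.IH h(1) card_image_le finite_window)
  finally show ?case by simp
qed

text \<open>Induction along an open path: what a step adds to the subtree lies in the window at the
  preceding endpoint, which an open bond forces into \<open>W\<close>. The identity is exempt
  because the empty path joins it to itself whatever \<open>W\<close> is.\<close>

lemma cluster_subtree_subset:
  assumes "same_cluster (open_bonds W) \<one>\<^bsub>\<Gamma>\<^esub> g"
  shows "g = \<one>\<^bsub>\<Gamma>\<^esub> \<or> subtree g \<subseteq> W"
  using assms unfolding same_cluster_def
proof (induction rule: rtrancl_induct)
  case (step h g)
  then have e: "{h, g} \<in> E" "sites {h, g} \<subseteq> W" by (auto simp: adj_def open_bonds_def)
  obtain s where s: "h \<in> carrier \<Gamma>" "s \<in> S" "g = h \<otimes>\<^bsub>\<Gamma>\<^esub> s" using edge_cases[OF e(1)] .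
  have win: "(\<lambda>z. snd h \<otimes>\<^bsub>F\<^esub> z) ` window \<subseteq> W" using e(2) by (auto simp: sites_def)
  \<comment> \<open>If \<open>h\<close> is the identity, the induction hypothesis gives nothing; the
    origin is then in \<open>W\<close> because \<open>[]\<close> lies in the window of the open bond
    leaving \<open>h\<close>.\<close>
  have "subtree h \<subseteq> W"
  proof (cases "h = \<one>\<^bsub>\<Gamma>\<^esub>")
    case True
    have "subtree h = {[]}" unfolding True by (rule subtree_one)
    moreover have "snd h = []" unfolding True by (simp add: one_wreath)
    ultimately show ?thesis using win Nil_in_window by auto
  qed (use step.IH in blast)
  then show ?case using subtree_step_subset[OF s(1,2)] win s(3) by blast
qed simp

section \<open>Lamplighter tours\<close>

text \<open>Two budgets are tracked at once: \<open>n\<close> bounds the graph distance, while the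
  size of \<open>W\<close> bounds the connection probability from below.\<close>

definition reach :: "letter list set \<Rightarrow> nat \<Rightarrow> (letter list \<Rightarrow> 'h) \<times> letter list \<Rightarrow>
    (letter list \<Rightarrow> 'h) \<times> letter list \<Rightarrow> bool" where
  "reach W n g h \<longleftrightarrow> (\<exists>m\<le>n. (g, h) \<in> adj (open_bonds W) ^^ m)"

lemma reach_refl: "reach W n g g"
  by (auto simp: reach_def intro!: exI[of _ 0])

lemma reach_trans:
  assumes "reach W n g h" "reach W m h k"
  shows "reach W (n + m) g k"
proof -
  from assms obtain i j where "i \<le> n" "(g, h) \<in> adj (open_bonds W) ^^ i"
    "j \<le> m" "(h, k) \<in> adj (open_bonds W) ^^ j" by (auto simp: reach_def)
  then show ?thesis unfolding reach_def by (blast intro: relpow_trans add_mono)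
qed

lemma reach_mono:
  assumes "reach W n g h" "W \<subseteq> W'" "n \<le> n'"
  shows "reach W' n' g h"
proof -
  from assms obtain m where "m \<le> n" "(g, h) \<in> adj (open_bonds W) ^^ m" by (auto simp: reach_def)
  moreover have "adj (open_bonds W) ^^ m \<subseteq> adj (open_bonds W') ^^ m"
    by (intro relpow_mono_rel adj_mono open_bonds_mono assms)
  ultimately show ?thesis using assms(3) unfolding reach_def by (meson subsetD le_trans)
qed

lemma bond_translate:
  assumes "k \<in> carrier \<Gamma>" "e \<in> E"
  shows "(\<lambda>x. k \<otimes>\<^bsub>\<Gamma>\<^esub> x) ` e \<in> E"
proof -
  from assms(2) obtain g s where gs: "e = {g, g \<otimes>\<^bsub>\<Gamma>\<^esub> s}" "g \<in> carrier \<Gamma>" "s \<in> S"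
    by (auto simp: cayley_edges_def)
  then have "(\<lambda>x. k \<otimes>\<^bsub>\<Gamma>\<^esub> x) ` e = {k \<otimes>\<^bsub>\<Gamma>\<^esub> g, (k \<otimes>\<^bsub>\<Gamma>\<^esub> g) \<otimes>\<^bsub>\<Gamma>\<^esub> s}"
    using G.m_assoc[OF assms(1) gs(2) subsetD[OF S_subset gs(3)]] by simp
  moreover have "k \<otimes>\<^bsub>\<Gamma>\<^esub> g \<in> carrier \<Gamma>" using gs assms(1) by simp
  ultimately show ?thesis using gs(3) unfolding cayley_edges_def by blast
qed

text \<open>Sites depend on positions only, and positions multiply.\<close>

lemma sites_translate:
  assumes "k \<in> carrier \<Gamma>" "e \<in> E"
  shows "sites ((\<lambda>x. k \<otimes>\<^bsub>\<Gamma>\<^esub> x) ` e) = (\<lambda>z. snd k \<otimes>\<^bsub>F\<^esub> z) ` sites e"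
proof -
  have "snd (k \<otimes>\<^bsub>\<Gamma>\<^esub> g) \<otimes>\<^bsub>F\<^esub> z = snd k \<otimes>\<^bsub>F\<^esub> (snd g \<otimes>\<^bsub>F\<^esub> z)" if "g \<in> e" "z \<in> window" for g z
  proof -
    have "snd k \<in> carrier F" "snd g \<in> carrier F" "z \<in> carrier F"
      using that assms edge_subset window_subset snd_closed by blast+
    then show ?thesis unfolding snd_mult by (rule F.m_assoc)
  qed
  then show ?thesis unfolding sites_def image_UN by (simp add: image_image)
qed

text \<open>Left multiplication by \<open>k\<close> maps bonds to bonds and moves their sites by
  \<open>snd k\<close>, so it carries open paths to open paths.\<close>

lemma reach_translate:
  assumes k: "k \<in> carrier \<Gamma>" and "reach W n g h"
  shows "reach ((\<lambda>z. snd k \<otimes>\<^bsub>F\<^esub> z) ` W) n (k \<otimes>\<^bsub>\<Gamma>\<^esub> g) (k \<otimes>\<^bsub>\<Gamma>\<^esub> h)"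
proof -
  let ?W = "(\<lambda>z. snd k \<otimes>\<^bsub>F\<^esub> z) ` W"
  have step: "(k \<otimes>\<^bsub>\<Gamma>\<^esub> x, k \<otimes>\<^bsub>\<Gamma>\<^esub> y) \<in> adj (open_bonds ?W)" if "(x, y) \<in> adj (open_bonds W)" for x y
  proof -
    have e: "{x, y} \<in> E" "sites {x, y} \<subseteq> W" using that by (auto simp: adj_def open_bonds_def)
    have "{k \<otimes>\<^bsub>\<Gamma>\<^esub> x, k \<otimes>\<^bsub>\<Gamma>\<^esub> y} \<in> E" using bond_translate[OF k e(1)] by simp
    moreover have "sites {k \<otimes>\<^bsub>\<Gamma>\<^esub> x, k \<otimes>\<^bsub>\<Gamma>\<^esub> y} \<subseteq> ?W"
      using sites_translate[OF k e(1)] e(2) by auto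
    ultimately show ?thesis by (simp add: adj_def open_bonds_def)
  qed
  have "(k \<otimes>\<^bsub>\<Gamma>\<^esub> g, k \<otimes>\<^bsub>\<Gamma>\<^esub> h) \<in> adj (open_bonds ?W) ^^ m" if "(g, h) \<in> adj (open_bonds W) ^^ m" for m
    using that
  proof (induction m arbitrary: h)
    case (Suc m)
    then obtain y where "(g, y) \<in> adj (open_bonds W) ^^ m" "(y, h) \<in> adj (open_bonds W)" by auto
    then show ?case using Suc.IH step by (meson relpow_Suc_I)
  qed simp
  then show ?thesis using assms(2) by (auto simp: reach_def)
qed

text \<open>Connectedness of the Cayley graph, recording the finitely many sites used: a product is
  reached by a path to \<open>g\<close> followed by the \<open>g\<close>-translate of a path to
  \<open>h\<close>.\<close>

lemma reach_exists:
  assumes "g \<in> carrier \<Gamma>"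
  shows "\<exists>n W. finite W \<and> W \<subseteq> carrier F \<and> reach W n \<one>\<^bsub>\<Gamma>\<^esub> g"
proof -
  have single: "\<exists>n W. finite W \<and> W \<subseteq> carrier F \<and> reach W n \<one>\<^bsub>\<Gamma>\<^esub> s" if "s \<in> S" for s
  proof -
    have s: "s \<in> carrier \<Gamma>" using that S_subset by blast
    have "{\<one>\<^bsub>\<Gamma>\<^esub>, \<one>\<^bsub>\<Gamma>\<^esub> \<otimes>\<^bsub>\<Gamma>\<^esub> s} \<in> E" using that unfolding cayley_edges_def by blast
    then have e: "{\<one>\<^bsub>\<Gamma>\<^esub>, s} \<in> E" using s by simp
    then have "(\<one>\<^bsub>\<Gamma>\<^esub>, s) \<in> adj (open_bonds (sites {\<one>\<^bsub>\<Gamma>\<^esub>, s})) ^^ 1"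
      by (simp add: adj_def open_bonds_def)
    then have "reach (sites {\<one>\<^bsub>\<Gamma>\<^esub>, s}) 1 \<one>\<^bsub>\<Gamma>\<^esub> s" unfolding reach_def by blast
    then show ?thesis using finite_sites[OF e] sites_subset[OF e] by blast
  qed
  have "g \<in> generate \<Gamma> S" using assms S_generates by simp
  then show ?thesis
  proof induction
    case one
    show ?case using reach_refl by blast
  next
    case (incl h)
    then show ?case by (rule single)
  next
    case (inv h)
    then show ?case by (intro single S_inv)
  next
    case (eng g h)
    then have gh: "g \<in> carrier \<Gamma>" "h \<in> carrier \<Gamma>" using S_generates by blast+
    from eng.IH obtain n W m W' where
      W: "finite W" "W \<subseteq> carrier F" "reach W n \<one>\<^bsub>\<Gamma>\<^esub> g"
      "finite W'" "W' \<subseteq> carrier F" "reach W' m \<one>\<^bsub>\<Gamma>\<^esub> h" by blast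
    let ?W' = "(\<lambda>z. snd g \<otimes>\<^bsub>F\<^esub> z) ` W'"
    have "?W' \<subseteq> carrier F"
      using W(5) snd_closed[OF gh(1)] by (intro image_subsetI F.m_closed) auto
    moreover have "reach (W \<union> ?W') (n + m) \<one>\<^bsub>\<Gamma>\<^esub> (g \<otimes>\<^bsub>\<Gamma>\<^esub> h)"
    proof (rule reach_trans)
      show "reach (W \<union> ?W') n \<one>\<^bsub>\<Gamma>\<^esub> g" using W(3) by (rule reach_mono) auto
      have "reach ?W' m g (g \<otimes>\<^bsub>\<Gamma>\<^esub> h)" using reach_translate[OF gh(1) W(6)] gh(1) by simp
      then show "reach (W \<union> ?W') m g (g \<otimes>\<^bsub>\<Gamma>\<^esub> h)" by (rule reach_mono) auto
    qed
    ultimately show ?case using W by (meson finite_UnI finite_imageI Un_least)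
  qed
qed

text \<open>Applied to the finite set of elementary moves, this yields the constants
  \<open>K\<close> and \<open>D\<close> of the tours; they are chosen before
  \<open>p\<close>.\<close>

lemma reach_uniform:
  assumes "finite A" "A \<subseteq> carrier \<Gamma>"
  shows "\<exists>n W. finite W \<and> W \<subseteq> carrier F \<and> (\<forall>g\<in>A. reach W n \<one>\<^bsub>\<Gamma>\<^esub> g)"
  using assms
proof (induction rule: finite_induct)
  case empty
  then show ?case by blast
next
  case (insert x A)
  then obtain n W m W' where
    "finite W" "W \<subseteq> carrier F" "\<forall>g\<in>A. reach W n \<one>\<^bsub>\<Gamma>\<^esub> g"
    "finite W'" "W' \<subseteq> carrier F" "reach W' m \<one>\<^bsub>\<Gamma>\<^esub> x"
    using reach_exists[of x] by auto
  moreover from this have "\<forall>g\<in>insert x A. reach (W \<union> W') (max n m) \<one>\<^bsub>\<Gamma>\<^esub> g"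
    by (auto intro: reach_mono)
  ultimately show ?case by (meson finite_UnI Un_least)
qed

section \<open>Elementary moves of the lamplighter\<close>

definition no_lamps :: "letter list \<Rightarrow> 'h" where
  "no_lamps = (\<lambda>z\<in>carrier F. \<one>\<^bsub>H\<^esub>)"

text \<open>The moves of the standard lamplighter: set the lamp at the current position, or walk
  along one letter. They need not belong to \<open>S\<close>; building tours from them makes the
  construction work for every generating set.\<close>

definition elementary :: "((letter list \<Rightarrow> 'h) \<times> letter list) set" where
  "elementary = (\<lambda>h. (no_lamps([] := h), [])) ` carrier H \<union>
    (\<lambda>a. (no_lamps, [a])) ` ({..<r} \<times> UNIV)"

lemma lamps_no_lamps: "lamps no_lamps = {}"
  by (auto simp: lamps_def no_lamps_def)

lemma position_closed: "x \<in> carrier F \<Longrightarrow> (no_lamps, x) \<in> carrier \<Gamma>"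
  by (simp add: carrier_wreath lamps_no_lamps) (simp add: no_lamps_def)

lemma letter_closed: "fst a < r \<Longrightarrow> [a] \<in> carrier F"
  by (simp add: free_group_def reduced_word_Cons)

lemma one_eq_no_lamps: "\<one>\<^bsub>\<Gamma>\<^esub> = (no_lamps, [])"
  by (simp add: one_wreath no_lamps_def)

lemma finite_elementary: "finite elementary"
  using finite_H by (simp add: elementary_def)

lemma elementary_subset: "elementary \<subseteq> carrier \<Gamma>"
proof -
  have "(no_lamps([] := h), []) \<in> carrier \<Gamma>" if "h \<in> carrier H" for h
  proof -
    have "lamps (no_lamps([] := h)) \<subseteq> {[]}" by (auto simp: lamps_def no_lamps_def)
    then have "finite (lamps (no_lamps([] := h)))" by (rule finite_subset) simp
    then show ?thesis using that Nil_closed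
      by (auto simp: carrier_wreath no_lamps_def PiE_iff extensional_def)
  qed
  then show ?thesis using position_closed letter_closed by (auto simp: elementary_def)
qed

lemma mult_position:
  assumes "(\<phi>, x) \<in> carrier \<Gamma>" "y \<in> carrier F"
  shows "(\<phi>, x) \<otimes>\<^bsub>\<Gamma>\<^esub> (no_lamps, y) = (\<phi>, x \<otimes>\<^bsub>F\<^esub> y)"
proof -
  have phi: "\<phi> \<in> carrier F \<rightarrow>\<^sub>E carrier H" and x: "x \<in> carrier F"
    using assms(1) by (simp_all add: carrier_wreath)
  have "translate F x no_lamps z = \<one>\<^bsub>H\<^esub>" if "z \<in> carrier F" for z
    using that F.m_closed[OF F.inv_closed[OF x] that] by (simp add: translate_def no_lamps_def)
  then have "(\<lambda>z\<in>carrier F. \<phi> z \<otimes>\<^bsub>H\<^esub> translate F x no_lamps z) = \<phi>"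
    using phi by (auto simp: fun_eq_iff PiE_iff extensional_def)
  then show ?thesis by (simp add: mult_wreath)
qed

lemma translate_letter:
  assumes "fst a < r" "a # w \<in> carrier F"
  shows "translate F [a] \<psi> (a # w) = \<psi> w"
proof -
  have "inv\<^bsub>F\<^esub> [a] \<otimes>\<^bsub>F\<^esub> (a # w) = w"
    using assms(1) by (simp add: inv_free_group_letter push_def)
  then show ?thesis using assms(2) by (simp add: translate_def)
qed

text \<open>If \<open>z\<close> does not begin with \<open>a\<close>, multiplication by the inverse
  letter causes no cancellation.\<close>

lemma translate_letter':
  assumes "fst a < r" "z \<in> carrier F" "\<And>w. z \<noteq> a # w"
  shows "translate F [a] \<psi> z = \<psi> (letter_inv a # z)"
proof -
  have "push (letter_inv a) z = letter_inv a # z"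
    using assms(3) by (cases z) (auto simp: push_def)
  then have "inv\<^bsub>F\<^esub> [a] \<otimes>\<^bsub>F\<^esub> z = letter_inv a # z"
    using assms(1) by (simp add: inv_free_group_letter)
  then show ?thesis using assms(2) by (simp add: translate_def)
qed

text \<open>The lamplighter lights the lamps of the branch starting with the letter \<open>a\<close> on an excursion
  that leaves from the origin and returns to it.\<close>

lemma lamps_split:
  assumes \<phi>: "\<phi> \<in> carrier F \<rightarrow>\<^sub>E carrier H" and T: "T \<subseteq> carrier F" "lamps \<phi> \<subseteq> T" "finite T" and a: "fst a < r"
  defines "\<psi> \<equiv> (\<lambda>z\<in>carrier F. if \<exists>w. z = a # w then \<one>\<^bsub>H\<^esub> else \<phi> z)"
    and "\<theta> \<equiv> (\<lambda>z\<in>carrier F. if a # z \<in> T then \<phi> (a # z) else \<one>\<^bsub>H\<^esub>)"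
  shows "(\<psi>, []) \<in> carrier \<Gamma>" "(\<theta>, []) \<in> carrier \<Gamma>"
    "lamps \<psi> \<subseteq> {v \<in> T. \<forall>w. v \<noteq> a # w}" "lamps \<theta> \<subseteq> {w. a # w \<in> T}"
    "(\<phi>, []) = (\<psi>, []) \<otimes>\<^bsub>\<Gamma>\<^esub> (no_lamps, [a]) \<otimes>\<^bsub>\<Gamma>\<^esub> (\<theta>, []) \<otimes>\<^bsub>\<Gamma>\<^esub> (no_lamps, [letter_inv a])"
proof -
  show L: "lamps \<psi> \<subseteq> {v \<in> T. \<forall>w. v \<noteq> a # w}" "lamps \<theta> \<subseteq> {w. a # w \<in> T}"
    using T(2) by (auto simp: lamps_def \<psi>_def \<theta>_def split: if_splits)
  have "{w. a # w \<in> T} \<subseteq> tl ` T" by force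
  then have fin: "finite (lamps \<psi>)" "finite (lamps \<theta>)"
    using L finite_subset[OF L(1)] T(3) finite_subset[of "lamps \<theta>" "tl ` T"] by auto
  have phiH: "\<phi> z \<in> carrier H" if "z \<in> carrier F" for z using that \<phi> by auto
  show cl: "(\<psi>, []) \<in> carrier \<Gamma>" "(\<theta>, []) \<in> carrier \<Gamma>"
    using fin phiH T(1) Nil_closed by (auto simp: carrier_wreath \<psi>_def \<theta>_def)
  have a': "[a] \<in> carrier F" "[letter_inv a] \<in> carrier F"
    using a by (auto intro: letter_closed simp: letter_inv_def)
  \<comment> \<open>No reduced word has \<open>a\<close> followed by its inverse, so
    \<open>\<theta>\<close> is trivial at words beginning with \<open>letter_inv a\<close>, and its
    translate by \<open>[a]\<close> lights nothing outside the branch.\<close>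
  have red: "a # letter_inv a # z \<notin> T" for z
    using T(1) by (auto simp: free_group_def reduced_word_Cons)
  \<comment> \<open>The lamps outside the branch come from \<open>\<psi>\<close>, those inside it
    from the translate of \<open>\<theta>\<close>; at each site at least one factor is
    trivial.\<close>
  have "(\<lambda>z\<in>carrier F. \<psi> z \<otimes>\<^bsub>H\<^esub> translate F [a] \<theta> z) = \<phi>"
  proof (rule extensionalityI[where A = "carrier F"])
    show "\<phi> \<in> extensional (carrier F)" using \<phi> by (simp add: PiE_iff)
    fix z assume z: "z \<in> carrier F"
    have zT: "\<phi> z = \<one>\<^bsub>H\<^esub>" if "z \<notin> T" using that T(2) z by (auto simp: lamps_def)
    have "\<psi> z \<otimes>\<^bsub>H\<^esub> translate F [a] \<theta> z = \<phi> z"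
    proof (cases "\<exists>w. z = a # w")
      case True
      then obtain w where w: "z = a # w" by blast
      have wF: "w \<in> carrier F" using z w by (auto simp: free_group_def reduced_word_Cons)
      have "translate F [a] \<theta> z = \<theta> w" using translate_letter[OF a] z w by simp
      also have "\<dots> = \<phi> z" using wF w zT by (auto simp: \<theta>_def)
      finally show ?thesis using z w phiH[OF z] by (simp add: \<psi>_def)
    next
      case False
      then have "translate F [a] \<theta> z = \<theta> (letter_inv a # z)" using translate_letter'[OF a z] by blast
      also have "letter_inv a # z \<in> carrier F"
        using z a False by (cases z) (auto simp: free_group_def reduced_word_Cons letter_inv_def)
      then have "\<theta> (letter_inv a # z) = \<one>\<^bsub>H\<^esub>" using red by (simp add: \<theta>_def)
      finally show ?thesis using z False phiH[OF z] by (simp add: \<psi>_def)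
    qed
    then show "(\<lambda>z\<in>carrier F. \<psi> z \<otimes>\<^bsub>H\<^esub> translate F [a] \<theta> z) z = \<phi> z" using z by simp
  qed simp
  then have m: "(\<psi>, [a]) \<otimes>\<^bsub>\<Gamma>\<^esub> (\<theta>, []) = (\<phi>, [a])"
    by (simp add: mult_wreath push_def)
  have "(\<phi>, [a]) \<in> carrier \<Gamma>" using \<phi> a' finite_subset[OF T(2,3)] by (simp add: carrier_wreath)
  then have "(\<phi>, [a]) \<otimes>\<^bsub>\<Gamma>\<^esub> (no_lamps, [letter_inv a]) = (\<phi>, [a] \<otimes>\<^bsub>F\<^esub> [letter_inv a])"
    using a'(2) by (rule mult_position)
  moreover have "(\<psi>, []) \<otimes>\<^bsub>\<Gamma>\<^esub> (no_lamps, [a]) = (\<psi>, [a])"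
    using mult_position[OF cl(1) a'(1)] by simp
  ultimately show "(\<phi>, []) = (\<psi>, []) \<otimes>\<^bsub>\<Gamma>\<^esub> (no_lamps, [a]) \<otimes>\<^bsub>\<Gamma>\<^esub> (\<theta>, []) \<otimes>\<^bsub>\<Gamma>\<^esub> (no_lamps, [letter_inv a])"
    using m by (simp add: push_def)
qed

section \<open>Tours through a finite subtree\<close>

definition thicken :: "letter list set \<Rightarrow> letter list set \<Rightarrow> letter list set" where
  "thicken D T = (\<Union>v\<in>T. (\<lambda>z. v \<otimes>\<^bsub>F\<^esub> z) ` D)"

lemma thicken_mono: "T \<subseteq> T' \<Longrightarrow> thicken D T \<subseteq> thicken D T'"
  by (auto simp: thicken_def)

lemma subset_thicken: "v \<in> T \<Longrightarrow> (\<lambda>z. v \<otimes>\<^bsub>F\<^esub> z) ` D \<subseteq> thicken D T"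
  by (auto simp: thicken_def)

text \<open>By the recursion of \<open>foldr\<close>, pushing \<open>a\<close> onto
  \<open>foldr push w z\<close> is \<open>foldr push (a # w) z\<close>, so no case distinction on
  cancellation arises.\<close>

lemma push_thicken_subset:
  "(\<And>w. w \<in> T \<Longrightarrow> a # w \<in> T') \<Longrightarrow> (\<lambda>z. [a] \<otimes>\<^bsub>F\<^esub> z) ` thicken D T \<subseteq> thicken D T'"
  by (force simp: thicken_def)

lemma card_thicken_le: 
  assumes "finite T" "finite D"
  shows "card (thicken D T) \<le> card T * card D"
proof -
  have "card (thicken D T) \<le> (\<Sum>v\<in>T. card ((\<lambda>z. v \<otimes>\<^bsub>F\<^esub> z) ` D))"
    unfolding thicken_def using assms(1) by (rule card_UN_le)
  also have "\<dots> \<le> (\<Sum>v\<in>T. card D)" by (intro sum_mono card_image_le assms)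
  finally show ?thesis by simp
qed

text \<open>Induction on the size of \<open>T\<close>. Removing the tree edge from the origin to a
  child \<open>[a]\<close> leaves two smaller trees. The tour serves the part at the origin, walks
  to \<open>[a]\<close>, serves the branch, and walks back. The count \<open>3 * n - 2\<close> is 1
  for a single vertex, and two counts plus the two connecting moves give the count of the
  sum.\<close>

lemma reach_lamps:
  assumes D: "\<And>g. g \<in> elementary \<Longrightarrow> reach D K \<one>\<^bsub>\<Gamma>\<^esub> g"
    and "finite T" "T \<subseteq> carrier F" "[] \<in> T" "\<And>v p. v \<in> T \<Longrightarrow> prefix p v \<Longrightarrow> p \<in> T"
    and "(\<phi>, []) \<in> carrier \<Gamma>" "lamps \<phi> \<subseteq> T"
  shows "reach (thicken D T) ((3 * card T - 2) * K) \<one>\<^bsub>\<Gamma>\<^esub> (\<phi>, [])"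
  using assms(2-)
proof (induction "card T" arbitrary: T \<phi> rule: less_induct)
  case less
  note T = less.prems
  have \<phi>: "\<phi> \<in> carrier F \<rightarrow>\<^sub>E carrier H" using T(5) by (simp add: carrier_wreath)
  show ?case
  proof (cases "T = {[]}")
    case True
    \<comment> \<open>Only the lamp at the origin can be lit, which takes one elementary
      move.\<close>
    have "\<phi> = no_lamps([] := \<phi> [])"
      using T(6) \<phi> Nil_closed unfolding True
      by (auto simp: fun_eq_iff lamps_def no_lamps_def PiE_iff extensional_def)
    moreover have "\<phi> [] \<in> carrier H" using \<phi> Nil_closed by auto
    ultimately have "(\<phi>, []) \<in> elementary" unfolding elementary_def by auto
    then show ?thesis using D True by (simp add: thicken_def)
  next
    case False
    then obtain v where v: "v \<in> T" "v \<noteq> []" using False T(3) by blast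
    then obtain a w where aw: "a # w \<in> T" by (cases v) auto
    then have aT: "[a] \<in> T" using T(4)[of "a # w" "[a]"] by simp
    then have a: "fst a < r" using T(2) by (auto simp: free_group_def)
    let ?A = "{w. a # w \<in> T}" and ?B = "{v \<in> T. \<forall>w. v \<noteq> a # w}"
    have TAB: "T = (#) a ` ?A \<union> ?B" by auto
    have finA: "finite ?A" using finite_subset[of ?A "tl ` T"] T(1) by force
    have finB: "finite ?B" using T(1) by simp
    have "card T = card ((#) a ` ?A) + card ?B"
      by (subst TAB, rule card_Un_disjoint) (use finA finB in auto)
    then have card: "card T = card ?A + card ?B" by (simp add: card_image)
    have NilA: "[] \<in> ?A" and NilB: "[] \<in> ?B" using aT T(3) by auto
    \<comment> \<open>As neither part is empty, both are strictly smaller than \<open>T\<close>, and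
      the subtraction of 2 below is never truncated.\<close>
    then have pos: "card ?A > 0" "card ?B > 0"
      using finA finB card_gt_0_iff by blast+
    define \<psi> where "\<psi> = (\<lambda>z\<in>carrier F. if \<exists>w. z = a # w then \<one>\<^bsub>H\<^esub> else \<phi> z)"
    define \<theta> where "\<theta> = (\<lambda>z\<in>carrier F. if a # z \<in> T then \<phi> (a # z) else \<one>\<^bsub>H\<^esub>)"
    note split = lamps_split[OF \<phi> T(2) T(6) T(1) a, folded \<psi>_def \<theta>_def]
    have B: "reach (thicken D ?B) ((3 * card ?B - 2) * K) \<one>\<^bsub>\<Gamma>\<^esub> (\<psi>, [])"
    proof (rule less.hyps)
      show "p \<in> ?B" if "v \<in> ?B" "prefix p v" for v p
        using that T(4) by (auto simp: prefix_def)
    qed (use card pos finB T(2,3) split(1,3) in auto)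
    have A: "reach (thicken D ?A) ((3 * card ?A - 2) * K) \<one>\<^bsub>\<Gamma>\<^esub> (\<theta>, [])"
    proof (rule less.hyps)
      show "p \<in> ?A" if "v \<in> ?A" "prefix p v" for v p
        using that T(4)[of "a # v" "a # p"] by simp
      show "?A \<subseteq> carrier F" using T(2) Cons_closedD(2) by blast
    qed (use card pos finA NilA split(2,4) in auto)
    have a': "[a] \<in> carrier F" "[letter_inv a] \<in> carrier F"
      using a by (auto intro: letter_closed simp: letter_inv_def)
    have el: "(no_lamps, [a]) \<in> elementary" "(no_lamps, [letter_inv a]) \<in> elementary"
      using a by (auto simp: elementary_def letter_inv_def image_iff mem_Times_iff)
    let ?g = "(\<psi>, [])" and ?a = "(no_lamps, [a])" and ?h = "(\<theta>, [])"
      and ?b = "(no_lamps, [letter_inv a])"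
    have cl: "?g \<in> carrier \<Gamma>" "?a \<in> carrier \<Gamma>" "?h \<in> carrier \<Gamma>" "?b \<in> carrier \<Gamma>"
      using split(1,2) position_closed a' by auto
    have ga: "?g \<otimes>\<^bsub>\<Gamma>\<^esub> ?a \<in> carrier \<Gamma>" and gah: "?g \<otimes>\<^bsub>\<Gamma>\<^esub> ?a \<otimes>\<^bsub>\<Gamma>\<^esub> ?h \<in> carrier \<Gamma>"
      using cl by simp_all
    have s: "snd (?g \<otimes>\<^bsub>\<Gamma>\<^esub> ?a) = [a]" "snd (?g \<otimes>\<^bsub>\<Gamma>\<^esub> ?a \<otimes>\<^bsub>\<Gamma>\<^esub> ?h) = [a]"
      unfolding snd_mult by (simp_all add: push_def)
    let ?W = "thicken D T"
    have r1: "reach ?W ((3 * card ?B - 2) * K) \<one>\<^bsub>\<Gamma>\<^esub> ?g"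
      using B by (rule reach_mono) (rule thicken_mono, auto)
    \<comment> \<open>The position of \<open>?g\<close> is \<open>[]\<close>, so this move uses the
      copy of \<open>D\<close> at the origin.\<close>
    have "reach D K ?g (?g \<otimes>\<^bsub>\<Gamma>\<^esub> ?a)"
      using reach_translate[OF cl(1) D[OF el(1)]] cl(1) by simp
    then have r2: "reach ?W K ?g (?g \<otimes>\<^bsub>\<Gamma>\<^esub> ?a)"
      by (rule reach_mono) (use subset_thicken[OF T(3), of D] in auto)
    \<comment> \<open>The tour for \<open>?A\<close> starts at the origin; translated to position
      \<open>[a]\<close> it serves the branch itself.\<close>
    have r3: "reach ?W ((3 * card ?A - 2) * K) (?g \<otimes>\<^bsub>\<Gamma>\<^esub> ?a) (?g \<otimes>\<^bsub>\<Gamma>\<^esub> ?a \<otimes>\<^bsub>\<Gamma>\<^esub> ?h)"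
      using reach_translate[OF ga A] unfolding s(1) G.r_one[OF ga]
      by (rule reach_mono) (rule push_thicken_subset, simp_all)
    have r4: "reach ?W K (?g \<otimes>\<^bsub>\<Gamma>\<^esub> ?a \<otimes>\<^bsub>\<Gamma>\<^esub> ?h) (?g \<otimes>\<^bsub>\<Gamma>\<^esub> ?a \<otimes>\<^bsub>\<Gamma>\<^esub> ?h \<otimes>\<^bsub>\<Gamma>\<^esub> ?b)"
      using reach_translate[OF gah D[OF el(2)]] unfolding s(2) G.r_one[OF gah]
      by (rule reach_mono) (use subset_thicken[OF aT, of D] in auto)
    have "reach ?W ((3 * card ?B - 2) * K + K + (3 * card ?A - 2) * K + K) \<one>\<^bsub>\<Gamma>\<^esub> (\<phi>, [])"
      unfolding split(5) by (intro reach_trans[OF reach_trans[OF reach_trans[OF r1 r2] r3] r4])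
    moreover have "(3 * card ?B - 2) * K + K + (3 * card ?A - 2) * K + K = (3 * card T - 2) * K"
    proof -
      obtain i j where "card ?A = Suc i" "card ?B = Suc j" using pos by (meson gr0_conv_Suc)
      then show ?thesis unfolding card by (simp add: algebra_simps)
    qed
    ultimately show ?thesis by simp
  qed
qed

text \<open>Walk to the first letter, then follow the translate by that letter of the path for the
  rest of the word.\<close>

lemma reach_position:
  assumes D: "\<And>g. g \<in> elementary \<Longrightarrow> reach D K \<one>\<^bsub>\<Gamma>\<^esub> g" and "x \<in> carrier F"
  shows "reach (thicken D {p. prefix p x}) (length x * K) \<one>\<^bsub>\<Gamma>\<^esub> (no_lamps, x)"
  using assms(2)
proof (induction x)
  case Nil
  then show ?case by (simp add: one_eq_no_lamps reach_refl)
next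
  case (Cons a x)
  then have x: "x \<in> carrier F" and a: "fst a < r"
    by (auto simp: free_group_def reduced_word_Cons)
  let ?W = "thicken D {p. prefix p (a # x)}"
  have el: "(no_lamps, [a]) \<in> elementary"
    using a by (auto simp: elementary_def image_iff mem_Times_iff)
  have cl: "(no_lamps, [a]) \<in> carrier \<Gamma>" by (intro position_closed letter_closed a)
  have "[] \<in> {p. prefix p (a # x)}" by simp
  from subset_thicken[OF this, of D] have r1: "reach ?W K \<one>\<^bsub>\<Gamma>\<^esub> (no_lamps, [a])"
    by (intro reach_mono[OF D[OF el]]) auto
  have "push a x = a # x"
    using Cons.prems by (intro push_Cons_reduced) (simp add: free_group_def)
  then have eq: "(no_lamps, [a]) \<otimes>\<^bsub>\<Gamma>\<^esub> (no_lamps, x) = (no_lamps, a # x)"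
    using mult_position[OF cl x] by simp
  have "reach ((\<lambda>z. snd (no_lamps, [a]) \<otimes>\<^bsub>F\<^esub> z) ` thicken D {p. prefix p x}) (length x * K)
      ((no_lamps, [a]) \<otimes>\<^bsub>\<Gamma>\<^esub> \<one>\<^bsub>\<Gamma>\<^esub>) ((no_lamps, [a]) \<otimes>\<^bsub>\<Gamma>\<^esub> (no_lamps, x))"
    by (rule reach_translate[OF cl Cons.IH[OF x]])
  then have "reach ?W (length x * K) (no_lamps, [a]) (no_lamps, a # x)"
    unfolding eq G.r_one[OF cl] snd_conv by (rule reach_mono) (rule push_thicken_subset, simp_all)
  from reach_trans[OF r1 this] show ?case by simp
qed

text \<open>The lamps are set first on a tour that returns to the origin, then the lamplighter walks
  to \<open>x\<close>. The factor 4 is 3 for the tour plus 1 for the walk, since the prefixes of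
  \<open>x\<close> lie in the subtree and outnumber its letters.\<close>

lemma reach_subtree:
  assumes D: "\<And>g. g \<in> elementary \<Longrightarrow> reach D K \<one>\<^bsub>\<Gamma>\<^esub> g" and g: "g \<in> carrier \<Gamma>"
  shows "reach (thicken D (subtree g)) (4 * K * card (subtree g)) \<one>\<^bsub>\<Gamma>\<^esub> g"
proof -
  obtain \<phi> x where gx: "g = (\<phi>, x)" by (cases g)
  have x: "x \<in> carrier F" and \<phi>: "(\<phi>, []) \<in> carrier \<Gamma>"
    using g Nil_closed by (simp_all add: gx carrier_wreath)
  let ?T = "subtree g"
  have lam: "lamps \<phi> \<subseteq> ?T" and xT: "{p. prefix p x} \<subseteq> ?T" by (auto simp: subtree_def gx)
  have r1: "reach (thicken D ?T) ((3 * card ?T - 2) * K) \<one>\<^bsub>\<Gamma>\<^esub> (\<phi>, [])"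
    by (intro reach_lamps D finite_subtree subtree_subset Nil_in_subtree g \<phi> lam)
      (auto intro: subtree_prefix_closed)
  have eq: "(\<phi>, []) \<otimes>\<^bsub>\<Gamma>\<^esub> (no_lamps, x) = g"
    using mult_position[OF \<phi> x] by (simp add: gx)
  have "reach ((\<lambda>z. snd (\<phi>, []) \<otimes>\<^bsub>F\<^esub> z) ` thicken D {p. prefix p x}) (length x * K)
      ((\<phi>, []) \<otimes>\<^bsub>\<Gamma>\<^esub> \<one>\<^bsub>\<Gamma>\<^esub>) ((\<phi>, []) \<otimes>\<^bsub>\<Gamma>\<^esub> (no_lamps, x))"
    by (rule reach_translate[OF \<phi> reach_position[OF D x]])
  then have "reach (thicken D {p. prefix p x}) (length x * K) (\<phi>, []) g"
    unfolding eq G.r_one[OF \<phi>] by simp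
  then have r2: "reach (thicken D ?T) (length x * K) (\<phi>, []) g"
    using thicken_mono[OF xT] by (rule reach_mono) simp
  have "card (set (prefixes x)) \<le> card ?T"
    using xT finite_subtree[OF g] by (intro card_mono) (auto simp: set_prefixes_eq)
  then have "length x \<le> card ?T" by simp
  then have "(3 * card ?T - 2) * K + length x * K \<le> (3 * card ?T) * K + card ?T * K"
    by (intro add_mono mult_right_mono) auto
  also have "\<dots> = 4 * K * card ?T" by simp
  finally show ?thesis using reach_mono[OF reach_trans[OF r1 r2] order.refl] by blast
qed

section \<open>Site percolation on the free group\<close>

definition site_measure :: "real \<Rightarrow> (letter list \<Rightarrow> bool) measure" where
  "site_measure p = PiM (carrier F) (\<lambda>_. measure_pmf (bernoulli_pmf p))"

text \<open>Site configurations are \<open>undefined\<close> outside \<open>carrier F\<close>, hence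
  the restriction to \<open>carrier F\<close> in the set of open sites.\<close>

definition percolation :: "real \<Rightarrow> ((letter list \<Rightarrow> 'h) \<times> letter list) set set measure" where
  "percolation p =
    distr (site_measure p) (config_space E) (\<lambda>\<eta>. open_bonds {v \<in> carrier F. \<eta> v})"

lemma prob_space_site_measure: "prob_space (site_measure p)"
  unfolding site_measure_def by (intro prob_space_PiM prob_space_measure_pmf)

lemma all_open_measurable:
  assumes "finite T" "T \<subseteq> carrier F"
  shows "{\<eta> \<in> space (site_measure p). \<forall>v\<in>T. \<eta> v} \<in> sets (site_measure p)"
proof (rule sets.sets_Collect_finite_All[OF _ assms(1)])
  fix v assume "v \<in> T"
  then have "(\<lambda>\<eta>. \<eta> v) \<in> measurable (site_measure p) (measure_pmf (bernoulli_pmf p))"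
    unfolding site_measure_def using assms(2) by (intro measurable_component_singleton) auto
  from measurable_sets[OF this, of "{True}"]
  show "{\<eta> \<in> space (site_measure p). \<eta> v} \<in> sets (site_measure p)"
    by (simp add: vimage_def Int_def conj_commute)
qed

lemma prob_all_open:
  assumes "finite T" "T \<subseteq> carrier F" "0 \<le> p" "p \<le> 1"
  shows "measure (site_measure p) {\<eta> \<in> space (site_measure p). \<forall>v\<in>T. \<eta> v} = p ^ card T"
proof -
  interpret P: product_prob_space "\<lambda>_. measure_pmf (bernoulli_pmf p)" "carrier F"
    by unfold_locales
  have "emeasure (site_measure p) {\<eta> \<in> space (site_measure p). \<forall>v\<in>T. \<eta> v \<in> {True}} =
      (\<Prod>v\<in>T. emeasure (measure_pmf (bernoulli_pmf p)) {True})"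
    unfolding site_measure_def using assms(1,2) by (intro P.emeasure_PiM_Collect) auto
  also have "\<dots> = ennreal (p ^ card T)"
    using assms(3,4) by (simp add: emeasure_pmf_single ennreal_power)
  finally show ?thesis using assms(3) by (simp add: measure_def)
qed

text \<open>A bond depends on finitely many sites only, so the event that it is open is a cylinder
  event.\<close>

lemma open_bonds_measurable:
  "(\<lambda>\<eta>. open_bonds {v \<in> carrier F. \<eta> v}) \<in> measurable (site_measure p) (config_space E)"
  unfolding config_space_def
proof (rule measurable_measure_of)
  show "{{\<omega> \<in> Pow E. e \<in> \<omega>} |e. e \<in> E} \<subseteq> Pow (Pow E)" by auto
  show "(\<lambda>\<eta>. open_bonds {v \<in> carrier F. \<eta> v}) \<in> space (site_measure p) \<rightarrow> Pow E"
    by (auto simp: open_bonds_def)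
  fix A assume "A \<in> {{\<omega> \<in> Pow E. e \<in> \<omega>} |e. e \<in> E}"
  then obtain e where e: "e \<in> E" "A = {\<omega> \<in> Pow E. e \<in> \<omega>}" by blast
  have "(\<lambda>\<eta>. open_bonds {v \<in> carrier F. \<eta> v}) -` A \<inter> space (site_measure p) =
      {\<eta> \<in> space (site_measure p). \<forall>v\<in>sites e. \<eta> v}"
    using e sites_subset[OF e(1)] by (auto simp: open_bonds_def)
  then show "(\<lambda>\<eta>. open_bonds {v \<in> carrier F. \<eta> v}) -` A \<inter> space (site_measure p) \<in> sets (site_measure p)"
    using all_open_measurable[OF finite_sites[OF e(1)] sites_subset[OF e(1)]] by simp
qed

lemma bond_percolation_percolation: "bond_percolation E (percolation p)"
  unfolding bond_percolation_def percolation_def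
  using prob_space.prob_space_distr[OF prob_space_site_measure open_bonds_measurable] by simp

lemma space_percolation: "space (percolation p) = Pow E"
  by (simp add: percolation_def)

lemma measure_percolation:
  assumes "{\<omega> \<in> Pow E. Q \<omega>} \<in> sets (config_space E)"
  shows "measure (percolation p) {\<omega> \<in> Pow E. Q \<omega>} =
    measure (site_measure p) {\<eta> \<in> space (site_measure p). Q (open_bonds {v \<in> carrier F. \<eta> v})}"
proof -
  have "(\<lambda>\<eta>. open_bonds {v \<in> carrier F. \<eta> v}) -` {\<omega> \<in> Pow E. Q \<omega>} \<inter> space (site_measure p) =
      {\<eta> \<in> space (site_measure p). Q (open_bonds {v \<in> carrier F. \<eta> v})}"
    by (auto simp: open_bonds_def)
  then show ?thesis
    unfolding percolation_def using measure_distr[OF open_bonds_measurable assms] by simp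
qed

section \<open>Invariance under left multiplication\<close>

lemma shift_open_bonds:
  assumes g: "g \<in> carrier \<Gamma>" and W: "W \<subseteq> carrier F"
  shows "shift_config \<Gamma> g (open_bonds W) = open_bonds ((\<lambda>z. snd g \<otimes>\<^bsub>F\<^esub> z) ` W)"
proof
  show "shift_config \<Gamma> g (open_bonds W) \<subseteq> open_bonds ((\<lambda>z. snd g \<otimes>\<^bsub>F\<^esub> z) ` W)"
    unfolding shift_config_def open_bonds_def
    using bond_translate[OF g] sites_translate[OF g] by (auto simp del: free_group_simps) (blast intro: imageI)
  show "open_bonds ((\<lambda>z. snd g \<otimes>\<^bsub>F\<^esub> z) ` W) \<subseteq> shift_config \<Gamma> g (open_bonds W)"
  proof
    fix e assume "e \<in> open_bonds ((\<lambda>z. snd g \<otimes>\<^bsub>F\<^esub> z) ` W)"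
    then have e: "e \<in> E" "sites e \<subseteq> (\<lambda>z. snd g \<otimes>\<^bsub>F\<^esub> z) ` W" by (auto simp: open_bonds_def)
    let ?e = "(\<lambda>x. inv\<^bsub>\<Gamma>\<^esub> g \<otimes>\<^bsub>\<Gamma>\<^esub> x) ` e"
    have e': "?e \<in> E" using g e(1) by (intro bond_translate) auto
    have "(\<lambda>x. g \<otimes>\<^bsub>\<Gamma>\<^esub> x) ` ?e = (\<lambda>x. x) ` e"
      unfolding image_image
      using edge_subset[OF e(1)] g by (intro image_cong) (auto simp: G.m_assoc[symmetric] simp del: split_paired_All)
    then have eq: "(\<lambda>x. g \<otimes>\<^bsub>\<Gamma>\<^esub> x) ` ?e = e" by simp
    \<comment> \<open>Left multiplication by \<open>snd g\<close> is injective on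
      \<open>carrier F\<close>, so it can be cancelled from the inclusion.\<close>
    have "(\<lambda>z. snd g \<otimes>\<^bsub>F\<^esub> z) ` sites ?e \<subseteq> (\<lambda>z. snd g \<otimes>\<^bsub>F\<^esub> z) ` W"
      using e(2) sites_translate[OF g e'] eq by simp
    then have "sites ?e \<subseteq> W"
      using inj_on_image_subset_iff[OF F.inj_on_cmult[OF snd_closed[OF g]] sites_subset[OF e'] W]
      by blast
    then have "?e \<in> open_bonds W" using e' by (simp add: open_bonds_def)
    then show "e \<in> shift_config \<Gamma> g (open_bonds W)"
      unfolding shift_config_def using eq by blast
  qed
qed

text \<open>Shifting the bonds by \<open>g\<close> amounts to shifting the sites by
  \<open>snd g\<close>, and a product of identical measures is invariant under permutations of the
  coordinates.\<close>

lemma invariant_percolation_percolation: "invariant_percolation \<Gamma> (percolation p)"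
  unfolding invariant_percolation_def
proof
  fix g assume g: "g \<in> carrier \<Gamma>"
  let ?M = "site_measure p" and ?\<Omega> = "\<lambda>\<eta>. open_bonds {v \<in> carrier F. \<eta> v}"
  define x where "x = snd g"
  have x: "x \<in> carrier F" using g by (simp add: x_def snd_closed)
  define \<rho> :: "(letter list \<Rightarrow> bool) \<Rightarrow> letter list \<Rightarrow> bool"
    where "\<rho> = (\<lambda>\<eta>. \<lambda>v\<in>carrier F. \<eta> (inv\<^bsub>F\<^esub> x \<otimes>\<^bsub>F\<^esub> v))"
  have x': "inv\<^bsub>F\<^esub> x \<in> carrier F" using x by (rule F.inv_closed)
  have cl: "inv\<^bsub>F\<^esub> x \<otimes>\<^bsub>F\<^esub> v \<in> carrier F" "x \<otimes>\<^bsub>F\<^esub> v \<in> carrier F" if "v \<in> carrier F" for v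
    using F.m_closed[OF x' that] F.m_closed[OF x that] .
  have canc: "x \<otimes>\<^bsub>F\<^esub> (inv\<^bsub>F\<^esub> x \<otimes>\<^bsub>F\<^esub> v) = v" "inv\<^bsub>F\<^esub> x \<otimes>\<^bsub>F\<^esub> (x \<otimes>\<^bsub>F\<^esub> v) = v" if "v \<in> carrier F" for v
    using F.m_assoc[OF x x' that] F.m_assoc[OF x' x that] F.r_inv[OF x] F.l_inv[OF x] F.l_one[OF that]
    by simp_all
  have rho: "distr ?M ?M \<rho> = ?M"
    unfolding site_measure_def \<rho>_def
    by (rule distr_PiM_reindex[where f = "\<lambda>v. inv\<^bsub>F\<^esub> x \<otimes>\<^bsub>F\<^esub> v" and M = "\<lambda>_. measure_pmf (bernoulli_pmf p)"])
      (use cl F.inj_on_cmult[OF x'] prob_space_measure_pmf in auto)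
  have rho_meas: "\<rho> \<in> measurable ?M ?M"
    unfolding site_measure_def \<rho>_def
    by (intro measurable_restrict measurable_component_singleton cl)
  have sh: "shift_config \<Gamma> g (?\<Omega> \<eta>) = ?\<Omega> (\<rho> \<eta>)" for \<eta>
  proof -
    have "(\<lambda>z. x \<otimes>\<^bsub>F\<^esub> z) ` {v \<in> carrier F. \<eta> v} = {v \<in> carrier F. \<rho> \<eta> v}"
    proof
      show "(\<lambda>z. x \<otimes>\<^bsub>F\<^esub> z) ` {v \<in> carrier F. \<eta> v} \<subseteq> {v \<in> carrier F. \<rho> \<eta> v}"
        using cl canc by (auto simp: \<rho>_def simp del: free_group_simps)
      show "{v \<in> carrier F. \<rho> \<eta> v} \<subseteq> (\<lambda>z. x \<otimes>\<^bsub>F\<^esub> z) ` {v \<in> carrier F. \<eta> v}"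
      proof
        fix v assume "v \<in> {v \<in> carrier F. \<rho> \<eta> v}"
        then have "v \<in> carrier F" "\<eta> (inv\<^bsub>F\<^esub> x \<otimes>\<^bsub>F\<^esub> v)" by (auto simp: \<rho>_def)
        then have "v = x \<otimes>\<^bsub>F\<^esub> (inv\<^bsub>F\<^esub> x \<otimes>\<^bsub>F\<^esub> v)" "inv\<^bsub>F\<^esub> x \<otimes>\<^bsub>F\<^esub> v \<in> {v \<in> carrier F. \<eta> v}"
          using cl canc by auto
        then show "v \<in> (\<lambda>z. x \<otimes>\<^bsub>F\<^esub> z) ` {v \<in> carrier F. \<eta> v}" by (rule image_eqI)
      qed
    qed
    then show ?thesis using shift_open_bonds[OF g, of "{v \<in> carrier F. \<eta> v}"] by (auto simp: x_def)
  qed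
  have smeas: "shift_config \<Gamma> g \<in> measurable (config_space E) (config_space E)"
    using G.group_axioms S_subset g by (rule shift_config_measurable)
  \<comment> \<open>The target measure of \<open>distr\<close> enters only through its space and its
    sets, so \<open>config_space E\<close> may replace it.\<close>
  have "distr (percolation p) (percolation p) (shift_config \<Gamma> g) =
      distr (percolation p) (config_space E) (shift_config \<Gamma> g)"
    by (rule distr_cong) (simp_all add: percolation_def)
  also have "\<dots> = distr ?M (config_space E) (shift_config \<Gamma> g \<circ> ?\<Omega>)"
    unfolding percolation_def by (rule distr_distr[OF smeas open_bonds_measurable])
  also have "shift_config \<Gamma> g \<circ> ?\<Omega> = ?\<Omega> \<circ> \<rho>"
    using sh by (simp add: fun_eq_iff)
  also have "distr ?M (config_space E) (?\<Omega> \<circ> \<rho>) = distr (distr ?M ?M \<rho>) (config_space E) ?\<Omega>"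
    by (rule distr_distr[OF open_bonds_measurable rho_meas, symmetric])
  also have "\<dots> = percolation p" unfolding rho percolation_def ..
  finally show "distr (percolation p) (percolation p) (shift_config \<Gamma> g) = percolation p" .
qed

section \<open>Expected degree of the identity\<close>

lemma prob_bond_open:
  assumes "e \<in> E" "0 \<le> p" "p \<le> 1"
  shows "measure (percolation p) {\<omega> \<in> Pow E. e \<in> \<omega>} = p ^ card (sites e)"
proof -
  have "{\<eta> \<in> space (site_measure p). e \<in> open_bonds {v \<in> carrier F. \<eta> v}} =
      {\<eta> \<in> space (site_measure p). \<forall>v\<in>sites e. \<eta> v}"
    using assms(1) sites_subset[OF assms(1)] by (auto simp: open_bonds_def)
  then show ?thesis
    using measure_percolation[OF edge_open_measurable]
      prob_all_open[OF finite_sites[OF assms(1)] sites_subset[OF assms(1)] assms(2,3)] by simp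
qed

lemma finite_incident: "finite {e \<in> E. \<one>\<^bsub>\<Gamma>\<^esub> \<in> e}"
proof (rule finite_subset)
  show "{e \<in> E. \<one>\<^bsub>\<Gamma>\<^esub> \<in> e} \<subseteq> (\<lambda>s. {\<one>\<^bsub>\<Gamma>\<^esub>, s}) ` S"
  proof
    fix e assume "e \<in> {e \<in> E. \<one>\<^bsub>\<Gamma>\<^esub> \<in> e}"
    then have "e \<in> E" "\<one>\<^bsub>\<Gamma>\<^esub> \<in> e" by auto
    from \<open>e \<in> E\<close> obtain g k where gk: "e = {g, k}" unfolding cayley_edges_def by blast
    obtain h where h: "e = {\<one>\<^bsub>\<Gamma>\<^esub>, h}"
    proof (cases "g = \<one>\<^bsub>\<Gamma>\<^esub>")
      case False
      then have "e = {\<one>\<^bsub>\<Gamma>\<^esub>, g}" using gk \<open>\<one>\<^bsub>\<Gamma>\<^esub> \<in> e\<close> by blast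
      then show thesis by (rule that)
    qed (use gk that in blast)
    with \<open>e \<in> E\<close> obtain s where s: "s \<in> S" "h = \<one>\<^bsub>\<Gamma>\<^esub> \<otimes>\<^bsub>\<Gamma>\<^esub> s" using edge_cases by blast
    then have "h = s" using G.l_one[OF subsetD[OF S_subset s(1)]] by simp
    then show "e \<in> (\<lambda>s. {\<one>\<^bsub>\<Gamma>\<^esub>, s}) ` S" using h s by blast
  qed
qed (use finite_S in simp)

text \<open>Linearity of expectation over the finitely many incident edges, each of which is open
  with probability at least \<open>p ^ (2 * card window)\<close>.\<close>

lemma expected_degree_ge:
  assumes "0 \<le> p" "p \<le> 1"
  shows "(\<integral>\<omega>. real (vertex_degree \<omega> \<one>\<^bsub>\<Gamma>\<^esub>) \<partial>percolation p) \<ge>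
    p ^ (2 * card window) * real (vertex_degree E \<one>\<^bsub>\<Gamma>\<^esub>)"
proof -
  let ?I = "{e \<in> E. \<one>\<^bsub>\<Gamma>\<^esub> \<in> e}" and ?P = "percolation p"
  interpret P: prob_space ?P
    using bond_percolation_percolation by (simp add: bond_percolation_def)
  have meas: "{\<omega> \<in> Pow E. e \<in> \<omega>} \<in> sets ?P" for e
    using edge_open_measurable[of E e] by (simp add: percolation_def)
  have deg: "real (vertex_degree \<omega> \<one>\<^bsub>\<Gamma>\<^esub>) = (\<Sum>e\<in>?I. indicator {\<omega> \<in> Pow E. e \<in> \<omega>} \<omega>)"
    if "\<omega> \<in> space ?P" for \<omega>
  proof -
    have "\<omega> \<subseteq> E" using that by (simp add: space_percolation)
    then have "{e \<in> \<omega>. \<one>\<^bsub>\<Gamma>\<^esub> \<in> e} = ?I \<inter> \<omega>" by blast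
    moreover have "(\<Sum>e\<in>?I. indicator {\<omega> \<in> Pow E. e \<in> \<omega>} \<omega> :: real) = (\<Sum>e\<in>?I. indicator \<omega> e)"
      using \<open>\<omega> \<subseteq> E\<close> by (intro sum.cong) (auto simp: indicator_def)
    moreover have "(\<Sum>e\<in>?I. indicator \<omega> e :: real) = (\<Sum>e\<in>?I \<inter> \<omega>. 1)"
      using finite_incident unfolding sum.inter_restrict[OF finite_incident]
      by (simp add: indicator_def of_bool_def)
    ultimately show ?thesis
      unfolding vertex_degree_def by simp
  qed
  have "p ^ (2 * card window) * real (vertex_degree E \<one>\<^bsub>\<Gamma>\<^esub>) = (\<Sum>e\<in>?I. p ^ (2 * card window))"
    by (simp add: vertex_degree_def)
  also have "\<dots> \<le> (\<Sum>e\<in>?I. p ^ card (sites e))"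
    using assms card_sites by (intro sum_mono power_decreasing) auto
  also have "\<dots> = (\<Sum>e\<in>?I. \<integral>\<omega>. indicator {\<omega> \<in> Pow E. e \<in> \<omega>} \<omega> \<partial>?P)"
  proof (rule sum.cong)
    fix e assume e: "e \<in> ?I"
    have "(\<integral>\<omega>. indicator {\<omega> \<in> Pow E. e \<in> \<omega>} \<omega> \<partial>?P) = P.prob ({\<omega> \<in> Pow E. e \<in> \<omega>} \<inter> space ?P)"
      by (rule Bochner_Integration.integral_indicator)
    also have "\<dots> = P.prob {\<omega> \<in> Pow E. e \<in> \<omega>}" by (simp only: sets.Int_space_eq2[OF meas])
    also have "\<dots> = p ^ card (sites e)" using prob_bond_open[OF _ assms] e by blast
    finally show "p ^ card (sites e) = (\<integral>\<omega>. indicator {\<omega> \<in> Pow E. e \<in> \<omega>} \<omega> \<partial>?P)" ..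
  qed simp
  also have "\<dots> = (\<integral>\<omega>. (\<Sum>e\<in>?I. indicator {\<omega> \<in> Pow E. e \<in> \<omega>} \<omega>) \<partial>?P)"
    using meas by (intro Bochner_Integration.integral_sum[symmetric] integrable_real_indicator) (auto simp: P.emeasure_eq_measure)
  also have "\<dots> = (\<integral>\<omega>. real (vertex_degree \<omega> \<one>\<^bsub>\<Gamma>\<^esub>) \<partial>?P)"
    using deg by (intro Bochner_Integration.integral_cong) auto
  finally show ?thesis .
qed

section \<open>The two-point function\<close>

lemma reach_imp_relpow: "reach W n g h \<Longrightarrow> \<exists>m\<le>n. (g, h) \<in> adj E ^^ m"
  using relpow_mono_rel[OF adj_mono[of "open_bonds W" E]]
  by (auto simp: reach_def open_bonds_def)

lemma graph_dist_le: "reach W n g h \<Longrightarrow> graph_dist E g h \<le> n"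
  using reach_imp_relpow[of W n g h] unfolding graph_dist_def by (meson Least_le le_trans)

lemma relpow_graph_dist:
  assumes "g \<in> carrier \<Gamma>"
  shows "(\<one>\<^bsub>\<Gamma>\<^esub>, g) \<in> adj E ^^ graph_dist E \<one>\<^bsub>\<Gamma>\<^esub> g"
proof -
  obtain m where "(\<one>\<^bsub>\<Gamma>\<^esub>, g) \<in> adj E ^^ m" using reach_exists[OF assms] reach_imp_relpow by blast
  then show ?thesis unfolding graph_dist_def by (rule LeastI)
qed

text \<open>The vertices at the end of paths of length \<open>n\<close> from the identity are finite
  in number, and these sets exhaust the group. Countability makes connection events
  measurable.\<close>

lemma countable_bonds: "countable E"
proof -
  have fin: "finite {g. (\<one>\<^bsub>\<Gamma>\<^esub>, g) \<in> adj E ^^ n}" for n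
  proof (induction n)
    case (Suc n)
    have "{g. (\<one>\<^bsub>\<Gamma>\<^esub>, g) \<in> adj E ^^ Suc n} \<subseteq> (\<lambda>(g, s). g \<otimes>\<^bsub>\<Gamma>\<^esub> s) ` ({g. (\<one>\<^bsub>\<Gamma>\<^esub>, g) \<in> adj E ^^ n} \<times> S)"
    proof
      fix g assume "g \<in> {g. (\<one>\<^bsub>\<Gamma>\<^esub>, g) \<in> adj E ^^ Suc n}"
      then obtain h where h: "(\<one>\<^bsub>\<Gamma>\<^esub>, h) \<in> adj E ^^ n" "{h, g} \<in> E" by (auto simp: adj_def)
      obtain s where "h \<in> carrier \<Gamma>" "s \<in> S" "g = h \<otimes>\<^bsub>\<Gamma>\<^esub> s" using edge_cases[OF h(2)] .
      then show "g \<in> (\<lambda>(g, s). g \<otimes>\<^bsub>\<Gamma>\<^esub> s) ` ({g. (\<one>\<^bsub>\<Gamma>\<^esub>, g) \<in> adj E ^^ n} \<times> S)"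
        using h(1) by (intro image_eqI[where x = "(h, s)"]) simp_all
    qed
    then show ?case using Suc finite_S by (meson finite_SigmaI finite_imageI finite_subset)
  qed simp
  have "carrier \<Gamma> \<subseteq> (\<Union>n. {g. (\<one>\<^bsub>\<Gamma>\<^esub>, g) \<in> adj E ^^ n})" using relpow_graph_dist by blast
  moreover have "countable (\<Union>n. {g. (\<one>\<^bsub>\<Gamma>\<^esub>, g) \<in> adj E ^^ n})"
    by (intro countable_UN countableI_type countable_finite fin)
  ultimately have "countable (carrier \<Gamma>)" by (rule countable_subset)
  moreover have "E \<subseteq> (\<lambda>(g, s). {g, g \<otimes>\<^bsub>\<Gamma>\<^esub> s}) ` (carrier \<Gamma> \<times> S)"
    by (force simp: cayley_edges_def)
  ultimately show ?thesis
    using finite_S by (meson countable_SIGMA countable_finite countable_image countable_subset)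
qed

lemma cluster_measurable: "{\<omega> \<in> Pow E. same_cluster \<omega> g h} \<in> sets (config_space E)"
  using countable_bonds finite_edge by (intro same_cluster_measurable) (auto intro: countable_finite)

lemma two_point_percolation:
  "two_point (percolation p) g h = measure (site_measure p)
    {\<eta> \<in> space (site_measure p). same_cluster (open_bonds {v \<in> carrier F. \<eta> v}) g h}"
  unfolding two_point_def space_percolation by (rule measure_percolation[OF cluster_measurable])

lemma cluster_sites_measurable:
  "{\<eta> \<in> space (site_measure p). same_cluster (open_bonds {v \<in> carrier F. \<eta> v}) g h}
    \<in> sets (site_measure p)"
proof -
  have "{\<eta> \<in> space (site_measure p). same_cluster (open_bonds {v \<in> carrier F. \<eta> v}) g h} =
      (\<lambda>\<eta>. open_bonds {v \<in> carrier F. \<eta> v}) -` {\<omega> \<in> Pow E. same_cluster \<omega> g h} \<inter> space (site_measure p)"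
    by (auto simp: open_bonds_def)
  also have "\<dots> \<in> sets (site_measure p)"
    by (rule measurable_sets[OF open_bonds_measurable cluster_measurable])
  finally show ?thesis .
qed

lemma two_point_refl: "two_point (percolation p) g g = 1"
proof -
  interpret P: prob_space "percolation p"
    using bond_percolation_percolation by (simp add: bond_percolation_def)
  show ?thesis using P.prob_space by (simp add: two_point_def same_cluster_def)
qed

text \<open>A connection forces all sites of the subtree to be open. At the identity the left side
  is 1 and the right side is \<open>p\<close>, so the bound fails there for
  \<open>p < 1\<close>.\<close>

lemma two_point_le:
  assumes "g \<in> carrier \<Gamma>" "g \<noteq> \<one>\<^bsub>\<Gamma>\<^esub>" "0 \<le> p" "p \<le> 1"
  shows "two_point (percolation p) \<one>\<^bsub>\<Gamma>\<^esub> g \<le> p ^ card (subtree g)"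
proof -
  interpret M: prob_space "site_measure p" by (rule prob_space_site_measure)
  note T = finite_subtree[OF assms(1)] subtree_subset[OF assms(1)]
  have "two_point (percolation p) \<one>\<^bsub>\<Gamma>\<^esub> g \<le>
      M.prob {\<eta> \<in> space (site_measure p). \<forall>v\<in>subtree g. \<eta> v}"
    unfolding two_point_percolation
    using cluster_subtree_subset[of _ g] assms(2)
    by (intro M.finite_measure_mono all_open_measurable T) auto
  then show ?thesis using prob_all_open[OF T assms(3,4)] by simp
qed

text \<open>When all sites of \<open>W\<close> are open, so is the path behind
  \<open>reach\<close>.\<close>

lemma two_point_ge:
  assumes "reach W n g h" "finite W" "W \<subseteq> carrier F" "0 \<le> p" "p \<le> 1"
  shows "p ^ card W \<le> two_point (percolation p) g h"
proof -
  interpret M: prob_space "site_measure p" by (rule prob_space_site_measure)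
  have "same_cluster (open_bonds {v \<in> carrier F. \<eta> v}) g h" if "\<forall>v\<in>W. \<eta> v" for \<eta>
  proof -
    have "W \<subseteq> {v \<in> carrier F. \<eta> v}" using that assms(3) by auto
    then have "reach {v \<in> carrier F. \<eta> v} n g h" by (intro reach_mono[OF assms(1)]) auto
    then show ?thesis unfolding reach_def same_cluster_def by (auto intro: relpow_imp_rtrancl)
  qed
  then have "M.prob {\<eta> \<in> space (site_measure p). \<forall>v\<in>W. \<eta> v} \<le> two_point (percolation p) g h"
    unfolding two_point_percolation
    by (intro M.finite_measure_mono cluster_sites_measurable) auto
  then show ?thesis using prob_all_open[OF assms(2-5)] by simp
qed

text \<open>A free generator makes the group nontrivial, so \<open>S\<close> is nonempty. The strict
  degree inequality of the theorem needs this.\<close>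

lemma degree_pos:
  assumes "r \<ge> 1"
  shows "vertex_degree E \<one>\<^bsub>\<Gamma>\<^esub> > 0"
proof -
  have "(no_lamps, [(0, True)]) \<in> carrier \<Gamma>"
    using assms by (intro position_closed letter_closed) simp
  moreover have "(no_lamps, [(0, True)]) \<noteq> \<one>\<^bsub>\<Gamma>\<^esub>" by (simp add: one_eq_no_lamps)
  ultimately have "S \<noteq> {}" using S_generates G.generate_empty by auto
  then obtain s where "s \<in> S" by blast
  then have "{\<one>\<^bsub>\<Gamma>\<^esub>, \<one>\<^bsub>\<Gamma>\<^esub> \<otimes>\<^bsub>\<Gamma>\<^esub> s} \<in> {e \<in> E. \<one>\<^bsub>\<Gamma>\<^esub> \<in> e}"
    unfolding cayley_edges_def by blast
  then show ?thesis unfolding vertex_degree_def using finite_incident card_gt_0_iff by blast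
qed

text \<open>The constants are fixed before \<open>p\<close>: both rates are multiples of
  \<open>- ln p\<close>, and their ratio does not change with \<open>p\<close>.\<close>

lemma exponential_decay:
  obtains a b :: real where "a > 0" "b > 0"
    "\<And>p g. 0 < p \<Longrightarrow> p < 1 \<Longrightarrow> g \<in> carrier \<Gamma> \<Longrightarrow>
      exp (a * ln p * real (graph_dist E \<one>\<^bsub>\<Gamma>\<^esub> g)) \<le> two_point (percolation p) \<one>\<^bsub>\<Gamma>\<^esub> g \<and>
      two_point (percolation p) \<one>\<^bsub>\<Gamma>\<^esub> g \<le> exp (b * ln p * real (graph_dist E \<one>\<^bsub>\<Gamma>\<^esub> g))"
proof -
  obtain K D where D: "finite D" "D \<subseteq> carrier F" "\<And>g. g \<in> elementary \<Longrightarrow> reach D K \<one>\<^bsub>\<Gamma>\<^esub> g"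
    using reach_uniform[OF finite_elementary elementary_subset] by blast
  \<comment> \<open>The first factor bounds the subtree per unit of distance, the second its
    thickening per vertex; the last \<open>+ 1\<close> keeps \<open>a\<close> positive even if
    \<open>D\<close> is empty.\<close>
  define a :: nat where "a = (1 + card window) * (card D + 1)"
  \<comment> \<open>A tour has length at most \<open>4 * K\<close> times the size of the subtree.
    For \<open>K = 0\<close> the \<open>+ 1\<close> avoids a division by 0, whose value 0 would not
    be a positive rate.\<close>
  define b :: real where "b = 1 / (4 * real K + 1)"
  show thesis
  proof (rule that)
    show "real a > 0" "b > 0" by (simp_all add: a_def b_def add_pos_nonneg)
    fix p :: real and g assume p: "0 < p" "p < 1" and g: "g \<in> carrier \<Gamma>"
    let ?n = "graph_dist E \<one>\<^bsub>\<Gamma>\<^esub> g" and ?T = "subtree g" and ?\<tau> = "two_point (percolation p) \<one>\<^bsub>\<Gamma>\<^esub> g"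
    have lnp: "ln p < 0" using p by simp
    show "exp (real a * ln p * real ?n) \<le> ?\<tau> \<and> ?\<tau> \<le> exp (b * ln p * real ?n)"
    proof (cases "g = \<one>\<^bsub>\<Gamma>\<^esub>")
      case True
      \<comment> \<open>At the identity all three quantities are 1.\<close>
      have "?n = 0" unfolding True graph_dist_def by (rule Least_eq_0) simp
      moreover have "?\<tau> = 1" unfolding True by (rule two_point_refl)
      ultimately show ?thesis by simp
    next
      case False
      have path: "(\<one>\<^bsub>\<Gamma>\<^esub>, g) \<in> adj E ^^ ?n" by (rule relpow_graph_dist[OF g])
      then have "?n \<noteq> 0" using False by (metis relpow_0_E)
      \<comment> \<open>Since \<open>?n\<close> is at least 1, it absorbs the additive 1 contributed
        by the origin.\<close>
      then have "card ?T \<le> (1 + card window) * ?n"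
        using card_subtree_le[OF path] by (simp add: algebra_simps)
      then have "card ?T * card D \<le> (1 + card window) * ?n * (card D + 1)"
        by (intro mult_mono) auto
      moreover have "card (thicken D ?T) \<le> card ?T * card D"
        by (intro card_thicken_le finite_subtree g D)
      ultimately have size: "card (thicken D ?T) \<le> a * ?n" by (simp add: a_def algebra_simps)
      have r: "reach (thicken D ?T) (4 * K * card ?T) \<one>\<^bsub>\<Gamma>\<^esub> g"
        by (rule reach_subtree[OF D(3) g])
      have "v \<otimes>\<^bsub>F\<^esub> z \<in> carrier F" if "v \<in> ?T" "z \<in> D" for v z
        using that D(2) subtree_subset[OF g] by (intro F.m_closed) auto
      then have sub: "thicken D ?T \<subseteq> carrier F" by (auto simp: thicken_def)
      have fin: "finite (thicken D ?T)" using D(1) finite_subtree[OF g] by (simp add: thicken_def)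
      have "exp (real a * ln p * real ?n) = p ^ (a * ?n)"
        using p by (simp add: exp_of_nat_mult[symmetric] mult_ac powr_realpow[symmetric] powr_def)
      also have "\<dots> \<le> p ^ card (thicken D ?T)" using size p by (intro power_decreasing) auto
      also have "\<dots> \<le> ?\<tau>" by (rule two_point_ge[OF r fin sub]) (use p in auto)
      finally have lower: "exp (real a * ln p * real ?n) \<le> ?\<tau>" .
      have "real ?n \<le> real (4 * K * card ?T)" using graph_dist_le[OF r] by (simp only: of_nat_le_iff)
      also have "\<dots> \<le> (4 * real K + 1) * real (card ?T)" by (simp add: algebra_simps)
      finally have "b * real ?n \<le> real (card ?T)" by (simp add: b_def field_simps)
      \<comment> \<open>Multiplication by the negative number \<open>ln p\<close> reverses the
        inequality.\<close>
      then have "real (card ?T) * ln p \<le> b * real ?n * ln p"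
        using lnp by (intro mult_right_mono_neg) auto
      then have "exp (real (card ?T) * ln p) \<le> exp (b * ln p * real ?n)" by (simp add: mult_ac)
      moreover have "?\<tau> \<le> p ^ card ?T" using two_point_le[OF g False] p by simp
      moreover have "exp (real (card ?T) * ln p) = p ^ card ?T" using p by (simp add: exp_of_nat_mult)
      ultimately show ?thesis using lower by simp
    qed
  qed
qed

end

section \<open>Choice of the density and of the two rates\<close>

theorem theorem1p3:
  fixes H :: "('h, 'c) monoid_scheme"
    and r :: nat
    and \<Gamma> :: "((letter list \<Rightarrow> 'h) \<times> letter list) monoid"
    and S :: "((letter list \<Rightarrow> 'h) \<times> letter list) set"
    and E :: "((letter list \<Rightarrow> 'h) \<times> letter list) set set"
  assumes "group H" and "finite (carrier H)" and "r \<ge> 1"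
    and "\<Gamma> = wreath_product H (free_group r)"
    and "finite S" and "symmetric_generating_set \<Gamma> S"
    and "E = cayley_edges \<Gamma> S"
  shows "\<exists>C::real. C > 0 \<and>
    (\<forall>\<alpha>::real. \<alpha> < 1 \<longrightarrow>
      (\<exists>P (\<beta>::real) (\<gamma>::real).
         bond_percolation E P \<and> invariant_percolation \<Gamma> P \<and>
         \<beta> > 0 \<and> \<gamma> > 0 \<and> \<beta> / \<gamma> \<le> C \<and>
         prob_space.expectation P (\<lambda>\<omega>. real (vertex_degree \<omega> \<one>\<^bsub>\<Gamma>\<^esub>)) > \<alpha> * real (vertex_degree E \<one>\<^bsub>\<Gamma>\<^esub>) \<and>
         (\<forall>g\<in>carrier \<Gamma>.
            exp (- \<beta> * real (graph_dist E \<one>\<^bsub>\<Gamma>\<^esub> g)) \<le> two_point P \<one>\<^bsub>\<Gamma>\<^esub> g \<and>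
            two_point P \<one>\<^bsub>\<Gamma>\<^esub> g \<le> exp (- \<gamma> * real (graph_dist E \<one>\<^bsub>\<Gamma>\<^esub> g)))))"
proof -
  interpret L: free_lamplighter H r S
    by (intro free_lamplighter.intro) (use assms in auto)
  obtain a b :: real where ab: "a > 0" "b > 0"
    and decay: "\<And>p g. 0 < p \<Longrightarrow> p < 1 \<Longrightarrow> g \<in> carrier \<Gamma> \<Longrightarrow>
      exp (a * ln p * real (graph_dist E \<one>\<^bsub>\<Gamma>\<^esub> g)) \<le> two_point (L.percolation p) \<one>\<^bsub>\<Gamma>\<^esub> g \<and>
      two_point (L.percolation p) \<one>\<^bsub>\<Gamma>\<^esub> g \<le> exp (b * ln p * real (graph_dist E \<one>\<^bsub>\<Gamma>\<^esub> g))"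
    unfolding assms(7) unfolding assms(4) by (rule L.exponential_decay) blast
  show ?thesis
  \<comment> \<open>The ratio \<open>a / b\<close> is available before \<alpha> is given.\<close>
  proof (intro exI[of _ "a / b"] conjI allI impI)
    show "a / b > 0" using ab by simp
    fix \<alpha> :: real assume "\<alpha> < 1"
    then obtain p where p: "0 < p" "p < 1" "\<alpha> < p ^ (2 * card L.window)"
      by (rule power_close_to_one)
    have lnp: "ln p < 0" using p by simp
    have deg: "real (vertex_degree E \<one>\<^bsub>\<Gamma>\<^esub>) > 0"
      using L.degree_pos[OF assms(3)] by (simp add: assms(4,7))
    have "\<alpha> * real (vertex_degree E \<one>\<^bsub>\<Gamma>\<^esub>) < p ^ (2 * card L.window) * real (vertex_degree E \<one>\<^bsub>\<Gamma>\<^esub>)"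
      using p(3) deg by (rule mult_strict_right_mono)
    also have "\<dots> \<le> (\<integral>\<omega>. real (vertex_degree \<omega> \<one>\<^bsub>\<Gamma>\<^esub>) \<partial>L.percolation p)"
      using L.expected_degree_ge[of p] p by (simp add: assms(4,7))
    finally have E: "\<alpha> * real (vertex_degree E \<one>\<^bsub>\<Gamma>\<^esub>) < \<dots>" .
    show "\<exists>P (\<beta>::real) (\<gamma>::real).
         bond_percolation E P \<and> invariant_percolation \<Gamma> P \<and>
         \<beta> > 0 \<and> \<gamma> > 0 \<and> \<beta> / \<gamma> \<le> a / b \<and>
         prob_space.expectation P (\<lambda>\<omega>. real (vertex_degree \<omega> \<one>\<^bsub>\<Gamma>\<^esub>)) > \<alpha> * real (vertex_degree E \<one>\<^bsub>\<Gamma>\<^esub>) \<and>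
         (\<forall>g\<in>carrier \<Gamma>.
            exp (- \<beta> * real (graph_dist E \<one>\<^bsub>\<Gamma>\<^esub> g)) \<le> two_point P \<one>\<^bsub>\<Gamma>\<^esub> g \<and>
            two_point P \<one>\<^bsub>\<Gamma>\<^esub> g \<le> exp (- \<gamma> * real (graph_dist E \<one>\<^bsub>\<Gamma>\<^esub> g)))"
    \<comment> \<open>Both rates are positive as \<open>ln p\<close> is negative, and
      \<open>ln p\<close> cancels in their ratio.\<close>
    proof (rule exI[of _ "L.percolation p"], rule exI[of _ "- (a * ln p)"], rule exI[of _ "- (b * ln p)"],
        intro conjI)
      show "bond_percolation E (L.percolation p)" "invariant_percolation \<Gamma> (L.percolation p)"
        using L.bond_percolation_percolation L.invariant_percolation_percolation
        by (simp_all add: assms(4,7))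
      show "- (a * ln p) > 0" "- (b * ln p) > 0" using ab lnp by (simp_all add: mult_pos_neg)
      show "- (a * ln p) / - (b * ln p) \<le> a / b" using lnp by simp
      show "\<alpha> * real (vertex_degree E \<one>\<^bsub>\<Gamma>\<^esub>) < (\<integral>\<omega>. real (vertex_degree \<omega> \<one>\<^bsub>\<Gamma>\<^esub>) \<partial>L.percolation p)"
        by (rule E)
      show "\<forall>g\<in>carrier \<Gamma>.
          exp (- (- (a * ln p)) * real (graph_dist E \<one>\<^bsub>\<Gamma>\<^esub> g)) \<le> two_point (L.percolation p) \<one>\<^bsub>\<Gamma>\<^esub> g \<and>
          two_point (L.percolation p) \<one>\<^bsub>\<Gamma>\<^esub> g \<le> exp (- (- (b * ln p)) * real (graph_dist E \<one>\<^bsub>\<Gamma>\<^esub> g))"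
        using decay[OF p(1,2)] by simp
    qed
  qed
qed

end
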